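(* Let $(W,T)$ be a (finite real) abstract reflection group. Let $w\in W$. If $w$ is a parabolic Coxeter element of $(W,T)$, then the action of the braid group $B_{l_T(w)}$ on $\operatorname{Red}_T(w)$ is transitive.
   Context: An abstract (finite real) reflection group is a pair $(W,T)$ where $W$ is a finite group, $T\subset W$ generates $W$, and there is a faithful representation $\rho:W\hookrightarrow \mathrm{GL}(V_{\mathbb R})$, $V_{\mathbb R}$ a finite-dimensional real vector space, such that for all $w\in W$: $\operatorname{codim}\ker(\rho(w)-\mathrm{Id})=1 \Leftrightarrow w\in T$. The set $T$ is closed under conjugation. For $w\in W$, $l_T(w)$ is the minimal length $n$ of a sequence $(t_1,\dots,t_n)$ of elements of $T$ with $w=t_1\cdots t_n$, and $\operatorname{Red}_T(w)$ is the set of such sequences of minimal length. A chromatic pair is an ordered pair $(L,R)$ of disjoint subsets of $T$ such that $\langle L\rangle$ and $\langle R\rangle$ are abelian and $(W,L\cup R)$ is a Coxeter system. The Coxeter elements of $(W,T)$ are the elements $\prod_{s\in L}s\prod_{s\in R}s$, $(L,R)$ a chromatic pair. A parabolic subgroup of $(W,T)$ is a reflection group $(W_I,T_I)$ with $W_I=\langle I\rangle$, $T_I=T\cap W_I$, where $I\subset S\subset T$ and $(W,S)$ is a Coxeter system. A parabolic Coxeter element is a Coxeter element of some parabolic subgroup. $B_n$ is the braid group on $n$ strings with standard generators $\sigma_1,\dots,\sigma_{n-1}$. It acts on $T^n$ by $$\sigma_i(a_1,\dots,a_n)=(a_1,\dots,a_{i-1},\,a_ia_{i+1}a_i^{-1},\,a_i,\,a_{i+2},\dots,a_n).$$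 This preserves the product $a_1\cdots a_n$, hence for $n=l_T(w)$ gives an action of $B_{l_T(w)}$ on $\operatorname{Red}_T(w)$. *)

theory Defs
  imports Complex_Main "HOL-Algebra.Multiplicative_Group" "HOL-Algebra.Generated_Groups"
    "HOL-Algebra.Group_Action"
begin

section \<open>Reflection groups\<close>

definition general_linear :: "('v::real_vector \<Rightarrow> 'v) monoid" where
  "general_linear = \<lparr>carrier = {f. linear f \<and> bij f}, mult = (\<circ>), one = id\<rparr>"

definition finite_dimensional :: "'v::real_vector itself \<Rightarrow> bool" where
  "finite_dimensional _ \<longleftrightarrow> (\<exists>B::'v set. finite B \<and> span B = UNIV)"

text \<open>The type \<^typ>\<open>'v\<close> is the space on which the group acts. A definition cannot quantify
  existentially over it, so it is a parameter here and a type variable of the theorem: a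
  hypothesis of this form, for arbitrary \<^typ>\<open>'v\<close>, says that some such space exists.
  The codimension condition on the kernel is written additively.\<close>

definition reflection_group ::
  "'v::real_vector itself \<Rightarrow> ('a, 'b) monoid_scheme \<Rightarrow> 'a set \<Rightarrow> bool" where
  "reflection_group V W T \<longleftrightarrow>
     group W \<and> finite (carrier W) \<and> T \<subseteq> carrier W \<and> generate W T = carrier W \<and>
     finite_dimensional V \<and>
     (\<exists>\<rho> :: 'a \<Rightarrow> 'v \<Rightarrow> 'v. \<rho> \<in> hom W general_linear \<and> inj_on \<rho> (carrier W) \<and>
        (\<forall>w\<in>carrier W. dim (UNIV :: 'v set) = dim {v. \<rho> w v - v = 0} + 1 \<longleftrightarrow> w \<in> T))"


section \<open>Group presentations\<close>

text \<open>A letter is a generator \<open>(x, True)\<close> or its formal inverse \<open>(x, False)\<close>;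
  a relation is a pair of words that are to become equal.\<close>

type_synonym 'x word = "('x \<times> bool) list"

abbreviation words :: "'x set \<Rightarrow> 'x word set" where
  "words X \<equiv> lists (X \<times> UNIV)"

inductive presented_eq :: "'x set \<Rightarrow> ('x word \<times> 'x word) set \<Rightarrow> 'x word \<Rightarrow> 'x word \<Rightarrow> bool"
  for X Q where
  refl: "u \<in> words X \<Longrightarrow> presented_eq X Q u u"
| sym: "presented_eq X Q u v \<Longrightarrow> presented_eq X Q v u"
| trans: "presented_eq X Q u v \<Longrightarrow> presented_eq X Q v w \<Longrightarrow> presented_eq X Q u w"
| cancel: "p \<in> words X \<Longrightarrow> q \<in> words X \<Longrightarrow> x \<in> X \<Longrightarrow>
    presented_eq X Q (p @ [(x, e), (x, \<not> e)] @ q) (p @ q)"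
| relation: "p \<in> words X \<Longrightarrow> q \<in> words X \<Longrightarrow> (u, v) \<in> Q \<Longrightarrow>
    presented_eq X Q (p @ u @ q) (p @ v @ q)"

definition presented_group :: "'x set \<Rightarrow> ('x word \<times> 'x word) set \<Rightarrow> 'x word set monoid" where
  "presented_group X Q =
    \<lparr>carrier = words X // {(u, v). presented_eq X Q u v},
     mult = (\<lambda>A B. {w. \<exists>a\<in>A. \<exists>b\<in>B. presented_eq X Q (a @ b) w}),
     one = {w. presented_eq X Q [] w}\<rparr>"


section \<open>Coxeter systems\<close>

definition word_value :: "('a, 'b) monoid_scheme \<Rightarrow> 'a word \<Rightarrow> 'a" where
  "word_value W u = foldr (\<lambda>(s, e) y. (if e then s else inv\<^bsub>W\<^esub> s) \<otimes>\<^bsub>W\<^esub> y) u \<one>\<^bsub>W\<^esub>"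

text \<open>The relations \<open>(s t)\<^sup>m = 1\<close>, with \<open>m\<close> the order of \<open>s t\<close> in the group.
  The case \<open>s = t\<close> gives \<open>s\<^sup>2 = 1\<close>; elements of infinite order have
  \<^const>\<open>group.ord\<close> equal to \<open>0\<close> and contribute only a trivial relation.\<close>

definition coxeter_relations :: "('a, 'b) monoid_scheme \<Rightarrow> 'a set \<Rightarrow> ('a word \<times> 'a word) set" where
  "coxeter_relations W S =
    {(concat (replicate (group.ord W (s \<otimes>\<^bsub>W\<^esub> t)) [(s, True), (t, True)]), []) | s t.
       s \<in> S \<and> t \<in> S}"

text \<open>The last conjunct says that the canonical surjection onto \<open>W\<close> from the group presented
  by the Coxeter relations is injective.\<close>

definition coxeter_system :: "('a, 'b) monoid_scheme \<Rightarrow> 'a set \<Rightarrow> bool" where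
  "coxeter_system W S \<longleftrightarrow>
     group W \<and> S \<subseteq> carrier W \<and> generate W S = carrier W \<and>
     (\<forall>s\<in>S. group.ord W s = 2) \<and>
     (\<forall>u\<in>words S. word_value W u = \<one>\<^bsub>W\<^esub> \<longrightarrow> presented_eq S (coxeter_relations W S) u [])"


section \<open>Parabolic Coxeter elements\<close>

definition chromatic_pair ::
  "('a, 'b) monoid_scheme \<Rightarrow> 'a set \<Rightarrow> 'a set \<Rightarrow> 'a set \<Rightarrow> bool" where
  "chromatic_pair W T L R \<longleftrightarrow>
     L \<subseteq> T \<and> R \<subseteq> T \<and> L \<inter> R = {} \<and>
     comm_group (W\<lparr>carrier := generate W L\<rparr>) \<and> comm_group (W\<lparr>carrier := generate W R\<rparr>) \<and>
     coxeter_system W (L \<union> R)"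

text \<open>The unordered products over \<open>L\<close> and \<open>R\<close> are taken in the abelian groups
  generated by these sets, since \<^const>\<open>finprod\<close> needs a commutative structure.\<close>

definition coxeter_elements :: "('a, 'b) monoid_scheme \<Rightarrow> 'a set \<Rightarrow> 'a set" where
  "coxeter_elements W T =
    {finprod (W\<lparr>carrier := generate W L\<rparr>) (\<lambda>s. s) L \<otimes>\<^bsub>W\<^esub>
     finprod (W\<lparr>carrier := generate W R\<rparr>) (\<lambda>s. s) R | L R. chromatic_pair W T L R}"

definition parabolic_subgroup ::
  "('a, 'b) monoid_scheme \<Rightarrow> 'a set \<Rightarrow> ('a, 'b) monoid_scheme \<Rightarrow> 'a set \<Rightarrow> bool" where
  "parabolic_subgroup W T W' T' \<longleftrightarrow>
    (\<exists>S I. I \<subseteq> S \<and> S \<subseteq> T \<and> coxeter_system W S \<and>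
       W' = W\<lparr>carrier := generate W I\<rparr> \<and> T' = T \<inter> carrier W')"

definition parabolic_coxeter_element :: "('a, 'b) monoid_scheme \<Rightarrow> 'a set \<Rightarrow> 'a \<Rightarrow> bool" where
  "parabolic_coxeter_element W T w \<longleftrightarrow>
    (\<exists>W' T'. parabolic_subgroup W T W' T' \<and> w \<in> coxeter_elements W' T')"


section \<open>Reduced decompositions\<close>

definition decompositions :: "('a, 'b) monoid_scheme \<Rightarrow> 'a set \<Rightarrow> 'a \<Rightarrow> 'a list set" where
  "decompositions W T w = {ts \<in> lists T. foldr (\<otimes>\<^bsub>W\<^esub>) ts \<one>\<^bsub>W\<^esub> = w}"

definition reflection_length :: "('a, 'b) monoid_scheme \<Rightarrow> 'a set \<Rightarrow> 'a \<Rightarrow> nat" where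
  "reflection_length W T w = (LEAST n. \<exists>ts\<in>decompositions W T w. length ts = n)"

definition Red :: "('a, 'b) monoid_scheme \<Rightarrow> 'a set \<Rightarrow> 'a \<Rightarrow> 'a list set" where
  "Red W T w = {ts \<in> decompositions W T w. length ts = reflection_length W T w}"


section \<open>The braid group and its action on sequences\<close>

definition braid_relations :: "nat \<Rightarrow> (nat word \<times> nat word) set" where
  "braid_relations n =
    {([(i, True), (j, True)], [(j, True), (i, True)]) | i j. 1 \<le> i \<and> i + 1 < j \<and> j < n} \<union>
    {([(i, True), (i + 1, True), (i, True)], [(i + 1, True), (i, True), (i + 1, True)]) | i.
       1 \<le> i \<and> i + 1 < n}"

definition braid_group :: "nat \<Rightarrow> nat word set monoid" where
  "braid_group n = presented_group {1..<n} (braid_relations n)"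

text \<open>Lists are indexed from \<open>0\<close>, so the generator with index \<open>i\<close> acts on the entries
  at positions \<open>i - 1\<close> and \<open>i\<close>. The formula for its inverse is obtained by solving
  \<open>(a b a\<^sup>-\<^sup>1, a) = (c, d)\<close> for \<open>(a, b)\<close>.\<close>

fun hurwitz_letter :: "('a, 'b) monoid_scheme \<Rightarrow> nat \<times> bool \<Rightarrow> 'a list \<Rightarrow> 'a list" where
  "hurwitz_letter W (i, True) xs =
    (let a = xs ! (i - 1); b = xs ! i
     in xs[i - 1 := a \<otimes>\<^bsub>W\<^esub> b \<otimes>\<^bsub>W\<^esub> inv\<^bsub>W\<^esub> a, i := a])"
| "hurwitz_letter W (i, False) xs =
    (let c = xs ! (i - 1); d = xs ! i
     in xs[i - 1 := d, i := inv\<^bsub>W\<^esub> d \<otimes>\<^bsub>W\<^esub> c \<otimes>\<^bsub>W\<^esub> d])"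

text \<open>The action of a braid is computed on a representing word; the choice is immaterial because
  the braid relations hold between the maps above. The restriction makes the maps extensional, as
  required by \<^const>\<open>BijGroup\<close>.\<close>

definition hurwitz_action ::
  "('a, 'b) monoid_scheme \<Rightarrow> 'a list set \<Rightarrow> nat word set \<Rightarrow> 'a list \<Rightarrow> 'a list" where
  "hurwitz_action W E \<beta> = restrict (foldr (hurwitz_letter W) (SOME u. u \<in> \<beta>)) E"

end

theory Submission
  imports Defs
begin

text \<open>In a Coxeter system, let \<open>t\<^sub>1 \<dots> t\<^sub>n\<close> be a product of reflections that no Hurwitz move turns into one
  with two equal neighbours, and follow the lengths of its suffix products. At a peak, the dihedral
  reflection subgroup generated by the two reflections involved offers a Hurwitz-equivalent pair
  with a lower middle vertex, since otherwise its coset would have two elements of minimal length.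
  Hence the Hurwitz orbit contains a word whose suffix products have increasing length. If
  the product is \<open>s\<^sub>1 \<dots> s\<^sub>k\<close> with distinct generators, the strong exchange condition deletes
  letters one at a time along this chain, and pushing the reflections to the places of the deleted letters
  yields \<open>(s\<^sub>1, \<dots>, s\<^sub>k)\<close>. Applied in \<open>W\<close>, the chain shows that all reduced decompositions of
  \<open>w\<close> lie in the parabolic subgroup; applied there, to the Coxeter system of the chromatic pair,
  it shows that they form one orbit. The representation only serves to identify \<open>T\<close> with the
  conjugates of the generators.\<close>

section \<open>Coxeter systems and the reflection cocycle\<close>

text \<open>Two features of the definitions shape the argument. The chromatic pair of the parabolic
  subgroup is only asked to be a Coxeter generating set inside \<open>T\<close>; it need not be the
  set \<open>I\<close> that cuts out the subgroup. Lengths in \<open>W\<close> and lengths in the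
  subgroup are therefore measured by a priori unrelated generators, a word that ascends for one need
  not ascend for the other, and this is why the reduction to ascending words is run twice. The two
  runs fit together because every Coxeter generating set of a subgroup that lies in \<open>T\<close>
  has the same reflections, namely all elements of \<open>T\<close> in that subgroup. Moreover, a
  Coxeter system is given here by a presentation, with no root system at hand. Inversion sets are
  built from a parity count on words that the relations preserve; comparisons of lengths then rest
  on the resulting cocycle identity and on the deletion of letters.\<close>

primrec list_prod :: "('a, 'b) monoid_scheme \<Rightarrow> 'a list \<Rightarrow> 'a" where
  "list_prod G [] = \<one>\<^bsub>G\<^esub>"
| "list_prod G (x # u) = x \<otimes>\<^bsub>G\<^esub> list_prod G u"

lemma foldr_mult_eq_list_prod: "foldr (\<otimes>\<^bsub>G\<^esub>) u \<one>\<^bsub>G\<^esub> = list_prod G u"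
  by (induction u) auto

context group
begin

abbreviation lprod :: "'a list \<Rightarrow> 'a" where
  "lprod \<equiv> list_prod G"

lemma lprod_closed [simp, intro]: "set u \<subseteq> carrier G \<Longrightarrow> lprod u \<in> carrier G"
  by (induction u) auto

lemma lprod_append [simp]:
  "set u \<subseteq> carrier G \<Longrightarrow> set v \<subseteq> carrier G \<Longrightarrow> lprod (u @ v) = lprod u \<otimes> lprod v"
  by (induction u) (auto simp: m_assoc)

lemma inv_mult_cancel:
  assumes "x \<in> carrier G" "y \<in> carrier G"
  shows "inv x \<otimes> (x \<otimes> y) = y" "x \<otimes> (inv x \<otimes> y) = y"
  using assms by (simp_all add: m_assoc[symmetric])

lemma lprod_in_generate: "set u \<subseteq> H \<Longrightarrow> H \<subseteq> carrier G \<Longrightarrow> lprod u \<in> generate G H"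
  by (induction u) (auto intro: generate.one generate.eng generate.incl)

end

section \<open>Words in Coxeter generators and the parity of crossings\<close>

locale coxeter = group G for G (structure) +
  fixes S :: "'a set"
  assumes coxeter: "coxeter_system G S"
begin

lemma S_carrier: "S \<subseteq> carrier G"
  using coxeter by (auto simp: coxeter_system_def)

lemma subset_S_closed [simp]: "A \<subseteq> S \<Longrightarrow> A \<subseteq> carrier G"
  using S_carrier by auto

lemma S_closed [simp, intro]: "s \<in> S \<Longrightarrow> s \<in> carrier G"
  using S_carrier by (rule subsetD)

lemma word_closed [simp, intro]: "set u \<subseteq> S \<Longrightarrow> lprod u \<in> carrier G"
  using S_carrier by auto

lemma S_sq: "s \<in> S \<Longrightarrow> s \<otimes> s = \<one>"
  using coxeter pow_ord_eq_1[of s]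
  by (auto simp: coxeter_system_def numeral_2_eq_2)

lemma S_neq_one: "s \<in> S \<Longrightarrow> s \<noteq> \<one>"
  using coxeter by (auto simp: coxeter_system_def)

lemma S_inv [simp]: "s \<in> S \<Longrightarrow> inv s = s"
  by (simp add: S_sq inv_equality)

lemma S_cancel [simp]: "s \<in> S \<Longrightarrow> x \<in> carrier G \<Longrightarrow> s \<otimes> (s \<otimes> x) = x"
  by (simp add: S_sq m_assoc[symmetric])

lemma lprod_rev: "set u \<subseteq> S \<Longrightarrow> lprod (rev u) = inv (lprod u)"
proof (induction u)
  case (Cons s u)
  then show ?case by (auto simp: inv_mult_group)
qed auto

lemma exists_word:
  assumes "w \<in> generate G J" "J \<subseteq> S"
  shows "\<exists>u. set u \<subseteq> J \<and> lprod u = w"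
  using assms(1)
proof (induction rule: generate.induct)
  case one
  show ?case by (rule exI[of _ "[]"]) auto
next
  case (incl h)
  then show ?case using assms by (intro exI[of _ "[h]"]) auto
next
  case (inv h)
  then show ?case using assms by (intro exI[of _ "[h]"]) auto
next
  case (eng h1 h2)
  then obtain u v where "set u \<subseteq> J" "lprod u = h1" "set v \<subseteq> J" "lprod v = h2" by metis
  moreover from this assms have "set u \<subseteq> S" "set v \<subseteq> S" by auto
  ultimately show ?case by (intro exI[of _ "u @ v"]) simp
qed

lemma exists_word_S: "w \<in> carrier G \<Longrightarrow> \<exists>u. set u \<subseteq> S \<and> lprod u = w"
  using exists_word[of w S] coxeter by (auto simp: coxeter_system_def)

text \<open>For a word \<open>s\<^sub>1 \<dots> s\<^sub>k\<close> this counts the indices \<open>i\<close> with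
  \<open>t = s\<^sub>1 \<dots> s\<^sub>i \<dots> s\<^sub>1\<close>.\<close>

primrec crossings :: "'a list \<Rightarrow> 'a \<Rightarrow> nat" where
  "crossings [] t = 0"
| "crossings (s # u) t = of_bool (t = s) + crossings u (s \<otimes> t \<otimes> s)"

lemma crossings_append:
  assumes "set u \<subseteq> S" "t \<in> carrier G"
  shows "crossings (u @ v) t = crossings u t + crossings v (inv (lprod u) \<otimes> t \<otimes> lprod u)"
  using assms
proof (induction u arbitrary: t)
  case (Cons s u)
  then show ?case by (auto simp: inv_mult_group m_assoc)
qed auto

lemma conj_S_eq_iff:
  assumes "s \<in> S" "x \<in> carrier G" "y \<in> carrier G"
  shows "s \<otimes> x \<otimes> s = y \<longleftrightarrow> x = s \<otimes> y \<otimes> s"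
  using assms S_sq[of s] by (auto simp: m_assoc)

text \<open>A counted index writes \<open>t\<close> as a letter conjugated by the prefix before it,
  so multiplication by \<open>t\<close> on the left cancels that letter. This is strong exchange for
  one fixed word; parity later makes the condition depend on the element alone.\<close>

lemma crossings_deletion:
  assumes "set u \<subseteq> S" "t \<in> carrier G" "crossings u t > 0"
  shows "\<exists>p s q. u = p @ s # q \<and> t = lprod p \<otimes> s \<otimes> inv (lprod p) \<and> t \<otimes> lprod u = lprod (p @ q)"
  using assms
proof (induction u arbitrary: t)
  case (Cons a u)
  show ?case
  proof (cases "t = a")
    case True
    then show ?thesis using Cons.prems
      by (intro exI[of _ "[]"] exI[of _ a] exI[of _ u]) auto
  next
    case False
    then obtain p s q where *: "u = p @ s # q" "a \<otimes> t \<otimes> a = lprod p \<otimes> s \<otimes> inv (lprod p)"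
      "(a \<otimes> t \<otimes> a) \<otimes> lprod u = lprod (p @ q)"
      using Cons.IH[of "a \<otimes> t \<otimes> a"] Cons.prems by auto
    have cl: "a \<in> S" "s \<in> S" "lprod p \<in> carrier G" "lprod u \<in> carrier G" "t \<in> carrier G"
      "lprod (p @ q) \<in> carrier G"
      using Cons.prems * by auto
    have "t = a \<otimes> (lprod p \<otimes> s \<otimes> inv (lprod p)) \<otimes> a"
      using *(2) cl conj_S_eq_iff[of a t] by auto
    also have "\<dots> = lprod (a # p) \<otimes> s \<otimes> inv (lprod (a # p))"
      using cl by (simp add: inv_mult_group m_assoc)
    finally have t: "t = lprod (a # p) \<otimes> s \<otimes> inv (lprod (a # p))" .
    have "t \<otimes> (a \<otimes> lprod u) = a \<otimes> ((a \<otimes> t \<otimes> a) \<otimes> lprod u)"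
      using cl by (simp add: m_assoc)
    then have "t \<otimes> lprod (a # u) = lprod ((a # p) @ q)"
      unfolding *(3) by simp
    moreover have "a # u = (a # p) @ s # q" using *(1) by simp
    ultimately show ?thesis using t by blast
  qed
qed auto

lemma even_crossings_pair:
  assumes "x \<in> S" "t \<in> carrier G"
  shows "even (crossings [x, x] t)"
proof -
  have "x \<otimes> t \<otimes> x = x \<longleftrightarrow> t = x"
    using assms S_sq[of x] by (subst conj_S_eq_iff) auto
  then show ?thesis using assms by auto
qed

text \<open>The prefixes of the alternating word meet the reflections \<open>(s t)^i s\<close> in
  the order of \<open>i\<close>. Stripping one block removes two letters and shifts \<open>i\<close>
  by two.\<close>

lemma crossings_relation:
  assumes "s \<in> S" "t \<in> S" "r \<in> carrier G"
  shows "crossings (concat (replicate k [s, t])) r = (\<Sum>i<2 * k. of_bool (r = (s \<otimes> t) [^] i \<otimes> s))"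
  using assms(3)
proof (induction k arbitrary: r)
  case (Suc k)
  have cl: "s \<otimes> t \<in> carrier G" using assms by auto
  have shift: "t \<otimes> (s \<otimes> r \<otimes> s) \<otimes> t = (s \<otimes> t) [^] i \<otimes> s \<longleftrightarrow> r = (s \<otimes> t) [^] Suc (Suc i) \<otimes> s" for i
  proof -
    have "t \<otimes> (s \<otimes> r \<otimes> s) \<otimes> t = (s \<otimes> t) [^] i \<otimes> s \<longleftrightarrow> r = s \<otimes> (t \<otimes> ((s \<otimes> t) [^] i \<otimes> s) \<otimes> t) \<otimes> s"
      using assms Suc.prems by (simp add: conj_S_eq_iff)
    also have "s \<otimes> (t \<otimes> ((s \<otimes> t) [^] i \<otimes> s) \<otimes> t) \<otimes> s = ((s \<otimes> t) \<otimes> ((s \<otimes> t) [^] i \<otimes> (s \<otimes> t))) \<otimes> s"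
      using assms by (simp add: m_assoc)
    also have "\<dots> = (s \<otimes> t) [^] Suc (Suc i) \<otimes> s"
      using nat_pow_Suc2[OF cl, of "Suc i"] by simp
    finally show ?thesis .
  qed
  have one: "s \<otimes> r \<otimes> s = t \<longleftrightarrow> r = (s \<otimes> t) [^] Suc 0 \<otimes> s"
    using assms Suc.prems by (simp add: conj_S_eq_iff)
  have "crossings (concat (replicate (Suc k) [s, t])) r =
    of_bool (r = (s \<otimes> t) [^] (0::nat) \<otimes> s) + (of_bool (r = (s \<otimes> t) [^] Suc 0 \<otimes> s) +
      (\<Sum>i<2 * k. of_bool (r = (s \<otimes> t) [^] Suc (Suc i) \<otimes> s)))"
    using assms Suc.prems Suc.IH[of "t \<otimes> (s \<otimes> r \<otimes> s) \<otimes> t"] 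
    by (simp add: one shift del: nat_pow_Suc)
  also have "\<dots> = (\<Sum>i<Suc (Suc (2 * k)). of_bool (r = (s \<otimes> t) [^] i \<otimes> s))"
    by (simp only: sum.lessThan_Suc_shift)
  finally show ?case by simp
qed auto

text \<open>Since \<open>(s t)^m = 1\<close>, the \<open>2 m\<close> reflections met are
  \<open>m\<close> of them run through twice. If the order is recorded as \<open>0\<close>, the word
  is empty.\<close>

lemma even_crossings_relation:
  assumes "s \<in> S" "t \<in> S" "r \<in> carrier G"
  shows "even (crossings (concat (replicate (ord (s \<otimes> t)) [s, t])) r)"
proof -
  let ?m = "ord (s \<otimes> t)" and ?f = "\<lambda>i. of_bool (r = (s \<otimes> t) [^] (i::nat) \<otimes> s) :: nat"
  have cl: "s \<otimes> t \<in> carrier G" using assms by auto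
  have "(s \<otimes> t) [^] (i + ?m) = (s \<otimes> t) [^] i" for i :: nat
    using cl by (simp add: nat_pow_mult[symmetric] pow_ord_eq_1)
  then have "(\<Sum>i<?m. ?f (i + ?m)) = (\<Sum>i<?m. ?f i)" by simp
  moreover have "(\<Sum>i<2 * ?m. ?f i) = (\<Sum>i<?m. ?f i) + (\<Sum>i<?m. ?f (i + ?m))"
    using sum.atLeastLessThan_concat[of 0 ?m "?m + ?m" ?f] sum.shift_bounds_nat_ivl[of ?f 0 ?m ?m]
    by (simp del: sum_of_bool_eq add: mult_2 lessThan_atLeast0)
  ultimately show ?thesis using crossings_relation[OF assms] by simp
qed

lemma lprod_relation:
  assumes "s \<in> S" "t \<in> S"
  shows "lprod (concat (replicate k [s, t])) = (s \<otimes> t) [^] k"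
proof (induction k)
  case (Suc k)
  then show ?case using assms nat_pow_Suc2[of "s \<otimes> t" k]
    by (simp add: m_assoc del: nat_pow_Suc)
qed auto

lemma presented_eq_crossings:
  assumes "presented_eq S (coxeter_relations G S) u v"
  shows "set (map fst u) \<subseteq> S \<and> set (map fst v) \<subseteq> S \<and>
    lprod (map fst u) = lprod (map fst v) \<and>
    (\<forall>t\<in>carrier G. even (crossings (map fst u) t + crossings (map fst v) t))"
  using assms
proof (induction rule: presented_eq.induct)
  case (refl u)
  then show ?case by (auto simp: lists_eq_set)
next
  case (sym u v)
  then show ?case by (auto simp: add.commute)
next
  case (trans u v w)
  then show ?case by (metis even_add)
next
  case (cancel p q x e)
  then have sub: "set (map fst p) \<subseteq> S" "set (map fst q) \<subseteq> S" by (auto simp: lists_eq_set)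
  have "even (crossings ([x, x] @ map fst q) r + crossings (map fst q) r)" if "r \<in> carrier G" for r
    using that cancel.hyps(3) even_crossings_pair[OF cancel.hyps(3) that] S_sq[of x]
    by (subst crossings_append) (auto simp del: crossings.simps)
  from this[of "inv (lprod (map fst p)) \<otimes> t \<otimes> lprod (map fst p)" for t]
  have "even (crossings (map fst p @ [x, x] @ map fst q) t + crossings (map fst p @ map fst q) t)"
    if "t \<in> carrier G" for t
    using that sub by (subst (1 2) crossings_append) (simp_all del: set_map crossings.simps append.simps)
  then show ?case using sub cancel.hyps(3) by (simp del: set_map crossings.simps)
next
  case (relation p q u v)
  then have sub: "set (map fst p) \<subseteq> S" "set (map fst q) \<subseteq> S" by (auto simp: lists_eq_set)
  obtain s t where st: "s \<in> S" "t \<in> S" and v: "v = []" 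
    and u: "map fst u = concat (replicate (ord (s \<otimes> t)) [s, t])"
    using relation by (auto simp: coxeter_relations_def map_concat)
  have su: "set (map fst u) \<subseteq> S" unfolding u using st by auto
  have lu: "lprod (map fst u) = \<one>" unfolding u using st
    by (subst lprod_relation) (auto simp: pow_ord_eq_1)
  have "even (crossings (map fst u) t)" if "t \<in> carrier G" for t
    unfolding u using even_crossings_relation st that by blast
  then have "even (crossings (map fst p @ map fst u @ map fst q) t + crossings (map fst p @ map fst q) t)"
    if "t \<in> carrier G" for t
    using that sub su lu by (simp add: crossings_append del: set_map)
  then show ?case using sub su lu v by (simp del: set_map)
qed

lemma word_value_map_True: "set u \<subseteq> S \<Longrightarrow> word_value G (map (\<lambda>s. (s, True)) u) = lprod u"
  by (induction u) (auto simp: word_value_def)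

lemma even_crossings_one:
  assumes "set u \<subseteq> S" "lprod u = \<one>" "t \<in> carrier G"
  shows "even (crossings u t)"
proof -
  let ?u = "map (\<lambda>s. (s, True)) u"
  have "?u \<in> words S" using assms by (auto simp: lists_eq_set)
  then have "presented_eq S (coxeter_relations G S) ?u []"
    using coxeter word_value_map_True assms unfolding coxeter_system_def by metis
  from presented_eq_crossings[OF this] show ?thesis using assms
    by (auto simp: comp_def)
qed

text \<open>Appending the reverse of \<open>v\<close> turns both words into words for the identity,
  which have even counts; the two added counts agree because they are taken after the same
  product.\<close>

lemma crossings_parity:
  assumes "set u \<subseteq> S" "set v \<subseteq> S" "lprod u = lprod v" "t \<in> carrier G"
  shows "odd (crossings u t) \<longleftrightarrow> odd (crossings v t)"
proof -
  let ?t = "inv (lprod v) \<otimes> t \<otimes> lprod v"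
  have "lprod (x @ rev v) = \<one>" if "set x \<subseteq> S" "lprod x = lprod v" for x
    using that assms by (auto simp: lprod_rev)
  then have "even (crossings (u @ rev v) t)" "even (crossings (v @ rev v) t)"
    using assms by (auto intro!: even_crossings_one)
  then show ?thesis using assms by (auto simp: crossings_append)
qed


section \<open>Reflections, inversions and length\<close>

definition refls :: "'a set" where
  "refls = {g \<otimes> s \<otimes> inv g | g s. g \<in> carrier G \<and> s \<in> S}"

text \<open>The left inversion set of \<open>w\<close>, defined by parity and not by length so that
  the cocycle identity is immediate. By \<open>crossings_parity\<close> any word for
  \<open>w\<close> gives the same answer.\<close>

definition inversion :: "'a \<Rightarrow> 'a \<Rightarrow> bool" where
  "inversion w t \<longleftrightarrow> (\<exists>u. set u \<subseteq> S \<and> lprod u = w \<and> odd (crossings u t))"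

definition len :: "'a \<Rightarrow> nat" where
  "len w = (LEAST n. \<exists>u. set u \<subseteq> S \<and> lprod u = w \<and> length u = n)"

lemma inversion_lprod:
  assumes "set u \<subseteq> S" "t \<in> carrier G"
  shows "inversion (lprod u) t \<longleftrightarrow> odd (crossings u t)"
  using crossings_parity assms unfolding inversion_def by metis

text \<open>The cocycle identity \<open>N(x y) = N(x) + x N(y) x^-1\<close> for inversion sets, with
  \<open>+\<close> the symmetric difference; it is the parity of
  \<open>crossings_append\<close>.\<close>

lemma inversion_mult:
  assumes "x \<in> carrier G" "y \<in> carrier G" "t \<in> carrier G"
  shows "inversion (x \<otimes> y) t \<longleftrightarrow> inversion x t \<noteq> inversion y (inv x \<otimes> t \<otimes> x)"
proof -
  obtain u v where uv: "set u \<subseteq> S" "lprod u = x" "set v \<subseteq> S" "lprod v = y"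
    using exists_word_S assms by metis
  have "inversion (lprod (u @ v)) t \<longleftrightarrow>
      inversion (lprod u) t \<noteq> inversion (lprod v) (inv (lprod u) \<otimes> t \<otimes> lprod u)"
    using uv assms by (subst (1 2 3) inversion_lprod) (auto simp: crossings_append simp del: lprod_append)
  then show ?thesis using uv by simp
qed

lemma not_inversion_one [simp]: "t \<in> carrier G \<Longrightarrow> \<not> inversion \<one> t"
  using inversion_lprod[of "[]" t] by simp

lemma inversion_generator: "s \<in> S \<Longrightarrow> t \<in> carrier G \<Longrightarrow> inversion s t \<longleftrightarrow> t = s"
  using inversion_lprod[of "[s]" t] by (simp add: S_closed)

text \<open>The strong exchange condition: an odd count is positive, so the given word has a letter
  to delete.\<close>

lemma inversion_deletion:
  assumes "set u \<subseteq> S" "t \<in> carrier G" "inversion (lprod u) t"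
  obtains p s q where "u = p @ s # q" "t = lprod p \<otimes> s \<otimes> inv (lprod p)" "t \<otimes> lprod u = lprod (p @ q)"
proof -
  have "crossings u t > 0"
    using assms by (auto simp: inversion_lprod odd_pos)
  then show thesis using crossings_deletion assms that by blast
qed

lemma refls_closed [simp, intro]: "t \<in> refls \<Longrightarrow> t \<in> carrier G"
  by (auto simp: refls_def)

lemma reflsE:
  assumes "t \<in> refls"
  obtains g s where "t = g \<otimes> s \<otimes> inv g" "g \<in> carrier G" "s \<in> S"
  using assms unfolding refls_def by blast

lemma S_refls: "s \<in> S \<Longrightarrow> s \<in> refls"
  unfolding refls_def by (intro CollectI exI[of _ \<one>] exI[of _ s]) (simp add: S_closed)

lemma refls_sq: "t \<in> refls \<Longrightarrow> t \<otimes> t = \<one>"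
proof -
  assume "t \<in> refls"
  then obtain g s where t: "t = g \<otimes> s \<otimes> inv g" "g \<in> carrier G" "s \<in> S"
    by (rule reflsE)
  have "t \<otimes> t = g \<otimes> (s \<otimes> s) \<otimes> inv g"
    unfolding t(1) using t(2,3) by (simp add: m_assoc inv_mult_cancel del: S_cancel)
  also have "\<dots> = \<one>" using t S_sq by auto
  finally show ?thesis .
qed

lemma refls_inv [simp]: "t \<in> refls \<Longrightarrow> inv t = t"
  by (simp add: refls_sq inv_equality)

lemma refls_cancel [simp]: "t \<in> refls \<Longrightarrow> x \<in> carrier G \<Longrightarrow> t \<otimes> (t \<otimes> x) = x"
  by (simp add: refls_sq m_assoc[symmetric])

lemma refls_conj: 
  assumes "t \<in> refls" "g \<in> carrier G"
  shows "g \<otimes> t \<otimes> inv g \<in> refls"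
proof -
  obtain h s where "t = h \<otimes> s \<otimes> inv h" "h \<in> carrier G" "s \<in> S" using assms by (blast elim: reflsE)
  then have "g \<otimes> t \<otimes> inv g = (g \<otimes> h) \<otimes> s \<otimes> inv (g \<otimes> h)" "g \<otimes> h \<in> carrier G" "s \<in> S"
    using assms by (auto simp: m_assoc inv_mult_group)
  then show ?thesis unfolding refls_def by blast
qed

lemma refls_conj_refl: "t \<in> refls \<Longrightarrow> r \<in> refls \<Longrightarrow> r \<otimes> t \<otimes> r \<in> refls"
  using refls_conj[of t r] by simp

text \<open>Apply the cocycle to \<open>g s g^-1\<close>. The contributions of \<open>g\<close> and
  \<open>inv g\<close> at \<open>t\<close> cancel, as the product \<open>g g^-1\<close> shows, and
  what remains is that \<open>s\<close> is an inversion of \<open>s\<close>.\<close>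

lemma inversion_self:
  assumes "t \<in> refls"
  shows "inversion t t"
proof -
  obtain g s where t: "t = g \<otimes> s \<otimes> inv g" "g \<in> carrier G" "s \<in> S"
    using assms by (rule reflsE)
  have cl: "s \<in> carrier G" using t by auto
  have "inversion ((g \<otimes> s) \<otimes> inv g) t \<longleftrightarrow> inversion (g \<otimes> s) t \<noteq> inversion (inv g) (inv (g \<otimes> s) \<otimes> t \<otimes> (g \<otimes> s))"
    using t cl assms by (intro inversion_mult) auto
  moreover have "inversion (g \<otimes> s) t \<longleftrightarrow> inversion g t \<noteq> inversion s (inv g \<otimes> t \<otimes> g)"
    using t cl assms by (intro inversion_mult) auto
  moreover have "inversion (g \<otimes> inv g) t \<longleftrightarrow> inversion g t \<noteq> inversion (inv g) (inv g \<otimes> t \<otimes> g)"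
    using t assms by (intro inversion_mult) auto
  moreover have "inv g \<otimes> t \<otimes> g = s"
    using t cl by (simp add: m_assoc inv_mult_cancel)
  moreover have "inv (g \<otimes> s) \<otimes> t \<otimes> (g \<otimes> s) = s"
    using t cl by (simp add: m_assoc inv_mult_cancel inv_mult_group)
  ultimately show ?thesis using t cl assms by (simp add: inversion_generator)
qed

lemma len_le: "set u \<subseteq> S \<Longrightarrow> len (lprod u) \<le> length u"
  unfolding len_def by (rule Least_le) auto

lemma reduced_word:
  assumes "w \<in> carrier G"
  obtains u where "set u \<subseteq> S" "lprod u = w" "length u = len w"
proof -
  obtain u where "set u \<subseteq> S" "lprod u = w" using exists_word_S assms by blast
  then have "\<exists>n. \<exists>u. set u \<subseteq> S \<and> lprod u = w \<and> length u = n" by blast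
  from LeastI_ex[OF this] show thesis using that unfolding len_def by blast
qed

lemma inversion_len:
  assumes "t \<in> carrier G" "w \<in> carrier G" "inversion w t"
  shows "len (t \<otimes> w) < len w"
proof -
  obtain u where u: "set u \<subseteq> S" "lprod u = w" "length u = len w"
    using reduced_word assms by blast
  then obtain p s q where "u = p @ s # q" "t \<otimes> w = lprod (p @ q)"
    using inversion_deletion[of u t] assms by metis
  then show ?thesis using len_le[of "p @ q"] u by auto
qed

text \<open>By \<open>inversion_self\<close>, multiplication by \<open>t\<close> toggles the
  inversion at \<open>t\<close>, so the strict drop applies to \<open>t w\<close>.\<close>

lemma not_inversion_len:
  assumes "t \<in> refls" "w \<in> carrier G" "\<not> inversion w t"
  shows "len w < len (t \<otimes> w)"
proof -
  have "inversion (t \<otimes> w) t"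
    using assms inversion_self[of t] inversion_mult[of t w t] refls_closed[of t] by (simp add: m_assoc refls_sq)
  then show ?thesis using inversion_len[of t "t \<otimes> w"] assms by simp
qed

lemma inversion_iff: "t \<in> refls \<Longrightarrow> w \<in> carrier G \<Longrightarrow> inversion w t \<longleftrightarrow> len (t \<otimes> w) < len w"
  using inversion_len not_inversion_len by (meson not_less_iff_gr_or_eq refls_closed)

lemma len_inv: 
  assumes "w \<in> carrier G"
  shows "len (inv w) = len w"
proof -
  have "len (inv x) \<le> len x" if x: "x \<in> carrier G" for x
  proof -
    obtain u where u: "set u \<subseteq> S" "lprod u = x" "length u = len x"
      using reduced_word[OF x] .
    then show ?thesis using len_le[of "rev u"] by (simp add: lprod_rev)
  qed
  from this[of w] this[of "inv w"] assms show ?thesis by simp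
qed

text \<open>Conjugating the set \<open>R\<close> by the first letter \<open>s\<^sub>1\<close> of a reflection \<open>s\<^sub>1 \<dots> s\<^sub>k \<dots> s\<^sub>1\<close> in it
  transports the cocycle as long as \<open>s\<^sub>1 \<notin> R\<close>, so one may assume that \<open>R\<close> contains a generator.\<close>

lemma exists_not_inversion:
  assumes "R \<subseteq> refls" "\<And>r r'. r \<in> R \<Longrightarrow> r' \<in> R \<Longrightarrow> r \<otimes> r' \<otimes> r \<in> R"
    "r1 \<in> R" "r2 \<in> R" "r1 \<noteq> r2"
  shows "\<exists>r\<in>R. \<exists>r'\<in>R. \<not> inversion r r'"
proof -
  obtain g s0 where "g \<in> carrier G" "s0 \<in> S" "r1 = g \<otimes> s0 \<otimes> inv g"
    using assms(1,3) by (blast elim: reflsE)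
  then obtain v where "set v \<subseteq> S" "r1 = lprod v \<otimes> s0 \<otimes> inv (lprod v)"
    using exists_word_S by metis
  then show ?thesis using assms
  proof (induction v arbitrary: R r1 r2)
    case Nil
    then have "r1 = s0" using \<open>s0 \<in> S\<close> by auto
    then show ?case using Nil inversion_generator[of s0 r2] \<open>s0 \<in> S\<close> by blast
  next
    case (Cons s v)
    have s: "s \<in> S" using Cons.prems by simp
    show ?case
    proof (cases "s \<in> R")
      case True
      obtain r where "r \<in> R" "r \<noteq> s" using Cons.prems by metis
      then show ?thesis using True s inversion_generator[of s r] Cons.prems by blast
    next
      case False
      let ?c = "\<lambda>x. s \<otimes> x \<otimes> s"
      have R: "\<And>r. r \<in> R \<Longrightarrow> r \<in> refls" using Cons.prems by auto
      have "\<exists>r\<in>?c ` R. \<exists>r'\<in>?c ` R. \<not> inversion r r'"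
      proof (rule Cons.IH)
        show "set v \<subseteq> S" using Cons.prems by simp
        show "?c r1 = lprod v \<otimes> s0 \<otimes> inv lprod v"
          using Cons.prems s \<open>s0 \<in> S\<close> S_sq[of s] by (simp add: inv_mult_group m_assoc)
        show "?c ` R \<subseteq> refls" using R s refls_conj_refl S_refls by auto
        show "?c r1 \<in> ?c ` R" "?c r2 \<in> ?c ` R" using Cons.prems by auto
        show "?c r1 \<noteq> ?c r2" using Cons.prems R[of r1] R[of r2] s by auto
        show "r \<otimes> r' \<otimes> r \<in> ?c ` R" if "r \<in> ?c ` R" "r' \<in> ?c ` R" for r r'
        proof -
          obtain x y where "x \<in> R" "r = ?c x" "y \<in> R" "r' = ?c y" using \<open>r \<in> ?c ` R\<close> \<open>r' \<in> ?c ` R\<close> by auto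
          moreover from this have "r \<otimes> r' \<otimes> r = ?c (x \<otimes> y \<otimes> x)"
            using s R[of x] R[of y] by (simp add: m_assoc)
          ultimately show ?thesis using Cons.prems(4) by auto
        qed
      qed
      then obtain r r' where r: "r \<in> R" "r' \<in> R" "\<not> inversion (?c r) (?c r')" by auto
      have cl: "r \<in> refls" "r' \<in> refls" "r \<in> carrier G" "r' \<in> carrier G" "s \<in> carrier G"
        using R r s by auto
      \<comment> \<open>The cocycle is applied twice to \<open>s r s\<close>. Both contributions of
        the letter \<open>s\<close> vanish because \<open>r'\<close> and \<open>r r' r\<close> lie
        in \<open>R\<close> and \<open>s\<close> does not.\<close>
      have ne: "r' \<noteq> s" "r \<otimes> r' \<otimes> r \<noteq> s" using False r Cons.prems(4) by metis+
      have "inversion (s \<otimes> (r \<otimes> s)) (?c r') \<longleftrightarrow> inversion s (?c r') \<noteq> inversion (r \<otimes> s) (inv s \<otimes> ?c r' \<otimes> s)"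
        using cl by (intro inversion_mult) auto
      moreover have "inv s \<otimes> ?c r' \<otimes> s = r'" using cl s S_sq[of s] by (simp add: m_assoc)
      moreover have "inversion (r \<otimes> s) r' \<longleftrightarrow> inversion r r' \<noteq> inversion s (r \<otimes> r' \<otimes> r)"
        using cl inversion_mult[of r s r'] by simp
      moreover have "?c r' \<noteq> s"
        using cl(4,5) s ne S_sq[of s] by (subst conj_S_eq_iff) (simp_all del: S_cancel)
      ultimately have "inversion r r' \<longleftrightarrow> inversion (?c r) (?c r')"
        using cl s ne by (simp add: inversion_generator m_assoc)
      then show ?thesis using r by auto
    qed
  qed
qed

end

section \<open>Hurwitz moves\<close>

text \<open>The condition \<open>c a = a b\<close> says \<open>c = a b a\<^sup>-\<^sup>1\<close> without mentioning inverses, whose definition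
  depends on the carrier; so moves in a subgroup are literally moves in the group.\<close>

inductive hurwitz_step :: "('a, 'b) monoid_scheme \<Rightarrow> 'a list \<Rightarrow> 'a list \<Rightarrow> bool" for G where
  "a \<in> carrier G \<Longrightarrow> b \<in> carrier G \<Longrightarrow> c \<in> carrier G \<Longrightarrow> c \<otimes>\<^bsub>G\<^esub> a = a \<otimes>\<^bsub>G\<^esub> b \<Longrightarrow>
    hurwitz_step G (p @ [a, b] @ q) (p @ [c, a] @ q)"

abbreviation hurwitz_equiv :: "('a, 'b) monoid_scheme \<Rightarrow> 'a list \<Rightarrow> 'a list \<Rightarrow> bool" where
  "hurwitz_equiv G \<equiv> equivclp (hurwitz_step G)"

lemma hurwitz_step_context: "hurwitz_step G x y \<Longrightarrow> hurwitz_step G (p @ x @ q) (p @ y @ q)"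
proof (induction rule: hurwitz_step.induct)
  case (1 a b c p' q')
  then show ?case using hurwitz_step.intros[of a G b c "p @ p'" "q' @ q"] by simp
qed

lemma hurwitz_equiv_context:
  assumes "hurwitz_equiv G x y"
  shows "hurwitz_equiv G (p @ x @ q) (p @ y @ q)"
  using assms
proof (induction rule: equivclp_induct)
  case (step y z)
  then have "hurwitz_equiv G (p @ y @ q) (p @ z @ q)"
    using hurwitz_step_context by (metis equivclp_sym r_into_equivclp)
  then show ?case using step equivclp_trans by metis
qed auto

lemma hurwitz_equiv_Cons: "hurwitz_equiv G x y \<Longrightarrow> hurwitz_equiv G (t # x) (t # y)"
  using hurwitz_equiv_context[of G x y "[t]" "[]"] by simp

lemma list_prod_append_cong: "list_prod G x = list_prod G y \<Longrightarrow> list_prod G (p @ x) = list_prod G (p @ y)"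
  by (induction p) auto

lemma hurwitz_equiv_length: "hurwitz_equiv G x y \<Longrightarrow> length x = length y"
  by (induction rule: equivclp_induct) (auto elim!: hurwitz_step.cases)

lemma (in group) hurwitz_step_list_prod:
  assumes "hurwitz_step G x y" "set x \<subseteq> carrier G \<or> set y \<subseteq> carrier G"
  shows "lprod x = lprod y \<and> set x \<subseteq> carrier G \<and> set y \<subseteq> carrier G"
  using assms
proof (induction rule: hurwitz_step.induct)
  case (1 a b c p q)
  then have *: "set (p @ [a, b] @ q) \<subseteq> carrier G" "set (p @ [c, a] @ q) \<subseteq> carrier G" by auto
  have "lprod ([a, b] @ q) = (a \<otimes> b) \<otimes> lprod q" "lprod ([c, a] @ q) = (c \<otimes> a) \<otimes> lprod q"
    using * by (simp_all add: m_assoc)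
  then have "lprod ([a, b] @ q) = lprod ([c, a] @ q)" using 1 by metis
  then show ?case using * list_prod_append_cong by metis
qed

lemma (in group) hurwitz_equiv_list_prod:
  assumes "hurwitz_equiv G x y" "set x \<subseteq> carrier G"
  shows "lprod x = lprod y \<and> set y \<subseteq> carrier G"
  using assms
proof (induction rule: equivclp_induct)
  case (step y z)
  then show ?case using hurwitz_step_list_prod[of y z] hurwitz_step_list_prod[of z y] by metis
qed auto

lemma (in group) hurwitz_equiv_closed:
  assumes "hurwitz_equiv G x y" "set x \<subseteq> T" "T \<subseteq> carrier G"
    and conj: "\<And>a b. a \<in> T \<Longrightarrow> b \<in> T \<Longrightarrow> a \<otimes> b \<otimes> inv a \<in> T \<and> inv a \<otimes> b \<otimes> a \<in> T"
  shows "set y \<subseteq> T"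
  using assms(1,2)
proof (induction rule: equivclp_induct)
  case (step y z)
  from step(2) consider "hurwitz_step G y z" | "hurwitz_step G z y" by auto
  then show ?case
  proof cases
    case 1
    then show ?thesis
    proof cases
      case (1 a b c p q)
      then have "c = a \<otimes> b \<otimes> inv a" by (metis inv_solve_right m_closed)
      then show ?thesis using 1 step conj[of a b] by auto
    qed
  next
    case 2
    then show ?thesis
    proof cases
      case (1 a b c p q)
      then have "b = inv a \<otimes> c \<otimes> a" by (metis inv_solve_left m_closed m_assoc inv_closed)
      then show ?thesis using 1 step conj[of a c] by auto
    qed
  qed
qed auto

section \<open>Dihedral reflection subgroups and peaks\<close>

context coxeter
begin

text \<open>The family \<open>r\<close> enumerates the reflections of the dihedral group of
  \<open>a\<close> and \<open>b\<close>, with \<open>r 0 = b\<close>, \<open>r 1 = a\<close> and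
  \<open>r (k + 1) r k = a b\<close>. Exponents are integers because Hurwitz moves rotate in both
  directions.\<close>

lemma refls_rotation:
  assumes "a \<in> refls" "b \<in> refls"
  defines "r \<equiv> \<lambda>k::int. (a \<otimes> b) [^] k \<otimes> b"
  shows "r i \<otimes> r j = (a \<otimes> b) [^] (i - j)" "r i \<otimes> (a \<otimes> b) = r (i - 1)" "r i \<in> refls"
proof -
  let ?m = "a \<otimes> b"
  have m: "?m \<in> carrier G" "a \<in> carrier G" "b \<in> carrier G" using assms by auto
  have b1: "b \<otimes> ?m = inv ?m \<otimes> b"
    using m refls_sq[OF assms(2)] assms(1,2) by (simp add: inv_mult_group m_assoc)
  have comm: "b \<otimes> ?m [^] j = ?m [^] (- j) \<otimes> b" for j :: int
  proof (induction j rule: int_induct[of _ 0])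
    case base
    then show ?case using m by simp
  next
    case (step1 i)
    have "b \<otimes> ?m [^] (i + 1) = (b \<otimes> ?m [^] i) \<otimes> ?m"
      using m int_pow_mult[of ?m i 1] by (simp add: m_assoc)
    also have "\<dots> = ?m [^] (- i) \<otimes> (b \<otimes> ?m)" unfolding step1(2) using m by (simp add: m_assoc)
    also have "\<dots> = ?m [^] (- i) \<otimes> inv ?m \<otimes> b" unfolding b1 using m by (simp add: m_assoc)
    also have "?m [^] (- i) \<otimes> inv ?m = ?m [^] (- (i + 1))"
      using m int_pow_mult[of ?m "-i" "-1"] by (simp add: int_pow_neg)
    finally show ?case .
  next
    case (step2 i)
    have b2: "b \<otimes> inv ?m = ?m \<otimes> b"
      using m refls_sq[OF assms(2)] assms(1,2) by (simp add: inv_mult_group m_assoc)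
    have "b \<otimes> ?m [^] (i - 1) = (b \<otimes> ?m [^] i) \<otimes> inv ?m"
      using m int_pow_mult[of ?m i "-1"] by (simp add: m_assoc int_pow_neg)
    also have "\<dots> = ?m [^] (- i) \<otimes> (b \<otimes> inv ?m)" unfolding step2(2) using m by (simp add: m_assoc)
    also have "\<dots> = ?m [^] (- i) \<otimes> ?m \<otimes> b" unfolding b2 using m by (simp add: m_assoc)
    also have "?m [^] (- i) \<otimes> ?m = ?m [^] (- (i - 1))"
      using m int_pow_mult[of ?m "-i" "1"] by simp
    finally show ?case .
  qed
  have rr: "r i \<otimes> r j = ?m [^] (i - j)" for i j
  proof -
    have "r i \<otimes> r j = ?m [^] i \<otimes> (b \<otimes> ?m [^] j) \<otimes> b" using m by (simp add: r_def m_assoc)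
    also have "\<dots> = ?m [^] i \<otimes> ?m [^] (- j)" unfolding comm using m assms by (simp add: m_assoc refls_sq)
    also have "\<dots> = ?m [^] (i - j)" using m int_pow_mult[of ?m i "-j"] by simp
    finally show ?thesis .
  qed
  then show "r i \<otimes> r j = ?m [^] (i - j)" .
  have rm: "?m [^] k \<otimes> r i = r (k + i)" for k i
    using m int_pow_mult[of ?m k i] by (simp add: r_def m_assoc)
  have "r i \<otimes> ?m = ?m [^] i \<otimes> (b \<otimes> ?m [^] (1::int))" using m by (simp add: r_def m_assoc)
  also have "\<dots> = ?m [^] i \<otimes> r (-1)" unfolding comm by (simp add: r_def)
  finally show "r i \<otimes> ?m = r (i - 1)" unfolding rm by simp
  \<comment> \<open>Reflecting \<open>r j\<close> in \<open>r i\<close> gives index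
    \<open>2 i - j\<close>; starting from \<open>r 0\<close> and \<open>r 1\<close> this reaches
    every index in both directions.\<close>
  have mid: "r (2 * i - j) \<in> refls" if "r i \<in> refls" "r j \<in> refls" for i j
  proof -
    have "r i \<otimes> r j \<otimes> r i = r (2 * i - j)" unfolding rr rm by (simp add: algebra_simps)
    then show ?thesis using refls_conj_refl[OF that(2,1)] by simp
  qed
  have "r i \<in> refls \<and> r (i + 1) \<in> refls"
  proof (induction i rule: int_induct[of _ 0])
    case base
    have "r 0 = b" "r 1 = a" using m assms by (auto simp: r_def m_assoc refls_sq)
    then show ?case using assms by simp
  next
    case (step1 i)
    then show ?case using mid[of "i + 1" i] by (simp add: algebra_simps)
  next
    case (step2 i)
    then show ?case using mid[of i "i + 1"] by (simp add: algebra_simps)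
  qed
  then show "r i \<in> refls" by simp
qed

text \<open>One move takes the pair at \<open>k\<close> to the pair at \<open>k + 1\<close> and its
  inverse goes back; the pair at \<open>k = 0\<close> is \<open>(a, b)\<close>.\<close>

lemma hurwitz_rotation:
  assumes "a \<in> refls" "b \<in> refls"
  shows "hurwitz_equiv G [a, b] [(a \<otimes> b) [^] (k + 1) \<otimes> b, (a \<otimes> b) [^] (k::int) \<otimes> b]"
proof -
  let ?r = "\<lambda>k::int. (a \<otimes> b) [^] k \<otimes> b"
  note rot = refls_rotation[OF assms]
  have step: "hurwitz_step G [?r (k + 1), ?r k] [?r (k + 2), ?r (k + 1)]" for k
    using hurwitz_step.intros[of "?r (k + 1)" G "?r k" "?r (k + 2)" "[]" "[]"] rot(1,3) by auto
  show ?thesis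
  proof (induction k rule: int_induct[of _ 0])
    case base
    have "?r 1 = a" "?r 0 = b" using assms refls_closed by (auto simp: m_assoc refls_sq)
    then show ?case by simp
  next
    case (step1 i)
    have "hurwitz_equiv G [?r (i + 1), ?r i] [?r (i + 1 + 1), ?r (i + 1)]"
      using r_into_equivclp[of "hurwitz_step G", OF step[of i]] by (simp only: add.assoc one_add_one)
    with step1(2) show ?case by (rule equivclp_trans)
  next
    case (step2 i)
    have "hurwitz_equiv G [?r (i - 1 + 1), ?r (i - 1)] [?r (i - 1 + 2), ?r (i - 1 + 1)]"
      by (rule r_into_equivclp) (rule step)
    moreover have "i - 1 + 2 = i + 1" "i - 1 + 1 = i" by auto
    ultimately have "hurwitz_equiv G [?r (i + 1), ?r i] [?r (i - 1 + 1), ?r (i - 1)]"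
      by (metis equivclp_sym)
    with step2(2) show ?case by (rule equivclp_trans)
  qed
qed

text \<open>The coset argument in terms of the cocycle: if no \<open>r k x\<close> is shorter than
  \<open>b x\<close>, then neither \<open>x\<close> nor \<open>a b x\<close> has an inversion among
  the \<open>r k\<close>. The cocycle passes this on to \<open>a b\<close> itself, which is
  impossible for \<open>a \<noteq> b\<close>.\<close>

lemma peak_reduction:
  assumes "a \<in> refls" "b \<in> refls" "a \<noteq> b" "x \<in> carrier G"
    and "len x < len (b \<otimes> x)" "len (a \<otimes> b \<otimes> x) < len (b \<otimes> x)"
  shows "\<exists>k::int. len ((a \<otimes> b) [^] k \<otimes> b \<otimes> x) < len (b \<otimes> x)"
proof (rule ccontr)
  let ?m = "a \<otimes> b"
  define r where "r = (\<lambda>k::int. ?m [^] k \<otimes> b)"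
  have rot: "r i \<otimes> r j = ?m [^] (i - j)" "r i \<otimes> ?m = r (i - 1)" "r i \<in> refls" for i j
    unfolding r_def using refls_rotation[OF assms(1,2)] by blast+
  have m: "?m \<in> carrier G" "a \<in> carrier G" "b \<in> carrier G" using assms by auto
  have r: "r k \<in> refls" "r k \<in> carrier G" for k using rot(3) by auto
  assume "\<not> ?thesis"
  then have min: "len (b \<otimes> x) \<le> len (r k \<otimes> x)" for k unfolding r_def by (meson not_less)
  have nx: "\<not> inversion x (r k)" for k
    using min[of k] assms(4,5) inversion_iff[OF r(1)[of k], of x] by simp
  have nmx: "\<not> inversion (?m \<otimes> x) (r k)" for k
  proof -
    have "r k \<otimes> (?m \<otimes> x) = r (k - 1) \<otimes> x"
      using rot(2)[of k] m r assms(4) by (metis m_assoc)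
    then show ?thesis using min[of "k - 1"] assms(4,6) m inversion_iff[OF r(1)[of k], of "?m \<otimes> x"] by simp
  qed
  have nm: "\<not> inversion ?m (r k)" for k
  proof -
    have "inv ?m \<otimes> (r k \<otimes> ?m) = r (k - 2)"
      unfolding rot(2) using m int_pow_mult[of ?m "-1" "k - 1"]
      by (simp add: r_def int_pow_neg m_assoc[symmetric])
    then have "inversion (?m \<otimes> x) (r k) \<longleftrightarrow> inversion ?m (r k) \<noteq> inversion x (r (k - 2))"
      using inversion_mult[of ?m x "r k"] m r assms(4) by (simp add: m_assoc)
    then show ?thesis using nx nmx by simp
  qed
  \<comment> \<open>As \<open>a b\<close> has no inversion among the \<open>r k\<close>, multiplying
    by it on the right changes none of them, so all \<open>r i\<close> have the same ones. Starting
    at \<open>i = k\<close> every pair becomes an inversion, against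
    \<open>exists_not_inversion\<close>.\<close>
  have step: "inversion (r (i - 1)) (r k) \<longleftrightarrow> inversion (r i) (r k)" for i k
  proof -
    have "r i \<otimes> r k \<otimes> r i = r (2 * i - k)"
      unfolding rot(1) using m int_pow_mult[of ?m "i - k" i] by (simp add: r_def m_assoc[symmetric] algebra_simps)
    then show ?thesis
      using inversion_mult[of "r i" ?m "r k"] m r nm by (simp add: rot(2))
  qed
  have "inversion (r i) (r k)" for i k
  proof (induction i rule: int_induct[of _ k])
    case base
    then show ?case using inversion_self r by simp
  next
    case (step1 i)
    then show ?case using step[of "i + 1" k] by simp
  next
    case (step2 i)
    then show ?case using step[of i k] by simp
  qed
  moreover have "\<exists>s\<in>range r. \<exists>s'\<in>range r. \<not> inversion s s'"
  proof (rule exists_not_inversion)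
    show "range r \<subseteq> refls" using r by auto
    show "s \<otimes> s' \<otimes> s \<in> range r" if "s \<in> range r" "s' \<in> range r" for s s'
    proof -
      obtain i j where "s = r i" "s' = r j" using \<open>s \<in> range r\<close> \<open>s' \<in> range r\<close> by blast
      then have "s \<otimes> s' \<otimes> s = r ((i - j) + i)"
        using rot(1)[of i j] m int_pow_mult[of ?m "i - j" i] by (simp add: r_def m_assoc)
      then show ?thesis by auto
    qed
    have "r 1 = a" "r 0 = b" using assms m by (auto simp: r_def m_assoc refls_sq)
    then show "a \<in> range r" "b \<in> range r" by (metis rangeI)+
    show "a \<noteq> b" by fact
  qed
  ultimately show False by auto
qed

section \<open>Ascending decompositions\<close>

primrec ascending :: "'a list \<Rightarrow> bool" where
  "ascending [] \<longleftrightarrow> True"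
| "ascending (t # u) \<longleftrightarrow> \<not> inversion (lprod u) t \<and> ascending u"

text \<open>Take the maximal ascending suffix: its first letter \<open>b\<close> raises the length
  and the letter \<open>a\<close> before it lowers it again. The suffix is nonempty because the
  identity has no inversions.\<close>

lemma not_ascending_peak:
  assumes "set ts \<subseteq> refls" "\<not> ascending ts"
  shows "\<exists>p a b q. ts = p @ [a, b] @ q \<and> len (lprod q) < len (b \<otimes> lprod q)
    \<and> len (a \<otimes> b \<otimes> lprod q) < len (b \<otimes> lprod q)"
  using assms
proof (induction ts)
  case (Cons a u)
  show ?case
  proof (cases "ascending u")
    case False
    then obtain p a' b q where "u = p @ [a', b] @ q" "len (lprod q) < len (b \<otimes> lprod q)"
      "len (a' \<otimes> b \<otimes> lprod q) < len (b \<otimes> lprod q)" using Cons by auto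
    then show ?thesis by (intro exI[of _ "a # p"]) auto
  next
    case True
    then have inv: "inversion (lprod u) a" using Cons by simp
    then obtain b q where u: "u = b # q" using Cons by (cases u) auto
    have cl: "a \<in> refls" "b \<in> refls" "lprod q \<in> carrier G" 
      using Cons.prems u by (auto intro!: lprod_closed)
    have "len (lprod q) < len (b \<otimes> lprod q)" using True u cl not_inversion_len by simp
    moreover have "len (a \<otimes> b \<otimes> lprod q) < len (b \<otimes> lprod q)"
      using inversion_len[of a "lprod u"] inv u cl refls_closed by (simp add: m_assoc)
    ultimately show ?thesis using u by (intro exI[of _ "[]"]) auto
  qed
qed simp

text \<open>A termination measure: rewriting at a peak fixes every suffix product except the middle
  one, so the sum drops together with the length of that vertex.\<close>

primrec weight :: "'a list \<Rightarrow> nat" where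
  "weight [] = 0"
| "weight (t # u) = len (lprod (t # u)) + weight u"

lemma weight_append_less:
  "lprod x = lprod y \<Longrightarrow> weight x < weight y \<Longrightarrow> weight (p @ x) < weight (p @ y)"
proof (induction p)
  case (Cons t p)
  then show ?case using list_prod_append_cong[of G x y p] by simp
qed auto

lemma hurwitz_ascending:
  assumes "set ts \<subseteq> refls" "\<And>p b q. \<not> hurwitz_equiv G ts (p @ [b, b] @ q)"
  shows "\<exists>us. hurwitz_equiv G ts us \<and> ascending us"
  using assms
proof (induction "weight ts" arbitrary: ts rule: less_induct)
  case less
  show ?case
  proof (cases "ascending ts")
    case False
    then obtain p a b q where ts: "ts = p @ [a, b] @ q" "len (lprod q) < len (b \<otimes> lprod q)"
      "len (a \<otimes> b \<otimes> lprod q) < len (b \<otimes> lprod q)"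
      using not_ascending_peak less.prems by metis
    have cl: "a \<in> refls" "b \<in> refls" "lprod q \<in> carrier G"
      using less.prems ts by (auto intro!: lprod_closed)
    \<comment> \<open>For equal letters the dihedral group degenerates. The hypothesis excludes them
      in the whole Hurwitz orbit, so it survives the replacement.\<close>
    have "a \<noteq> b" using less.prems(2)[of p b q] ts by auto
    then obtain k :: int where k: "len ((a \<otimes> b) [^] k \<otimes> b \<otimes> lprod q) < len (b \<otimes> lprod q)"
      using peak_reduction cl ts by metis
    let ?r = "\<lambda>k::int. (a \<otimes> b) [^] k \<otimes> b"
    let ?us = "p @ [?r (k + 1), ?r k] @ q"
    have eq: "hurwitz_equiv G ts ?us"
      unfolding ts by (rule hurwitz_equiv_context) (rule hurwitz_rotation[OF cl(1,2)])
    have r: "?r (k + 1) \<in> refls" "?r k \<in> refls" using refls_rotation(3) cl by auto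
    have "?r (k + 1) \<otimes> ?r k = a \<otimes> b" using refls_rotation(1)[OF cl(1,2), of "k + 1" k] cl by auto
    then have same: "?r (k + 1) \<otimes> (?r k \<otimes> lprod q) = a \<otimes> (b \<otimes> lprod q)"
      using r cl by (metis m_assoc refls_closed)
    have "weight ?us < weight ts"
      unfolding ts(1) by (rule weight_append_less) (use same k in simp_all)
    moreover have "set ?us \<subseteq> refls" using less.prems(1) ts(1) r by auto
    moreover have "\<not> hurwitz_equiv G ?us (p' @ [c, c] @ q')" for p' c q'
      using less.prems(2) eq equivclp_trans by metis
    ultimately obtain us where "hurwitz_equiv G ?us us" "ascending us" using less.hyps by blast
    then show ?thesis using eq equivclp_trans by metis
  qed (metis equivclp_refl)
qed

text \<open>The first letter is an inversion of the product, so exchange deletes a letter from a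
  word over \<open>I\<close>. The remaining product thus stays in the subgroup, and the first letter
  is a quotient of two of its elements.\<close>

lemma ascending_in_parabolic:
  assumes "set ts \<subseteq> refls" "ascending ts" "lprod ts \<in> generate G I" "I \<subseteq> S"
  shows "set ts \<subseteq> generate G I"
  using assms
proof (induction ts)
  case (Cons t us)
  have I: "I \<subseteq> carrier G" using Cons by auto
  have sg: "subgroup (generate G I) G" using I generate_is_subgroup by blast
  have t: "t \<in> refls" "t \<in> carrier G" and us: "lprod us \<in> carrier G"
    using Cons.prems by (auto intro!: lprod_closed)
  let ?w = "lprod (t # us)"
  have w: "?w \<in> carrier G" "t \<otimes> ?w = lprod us" using t us by auto
  have "inversion ?w t" using inversion_iff[of t ?w] not_inversion_len[of t "lprod us"] w t us Cons.prems by simp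
  moreover obtain u where u: "set u \<subseteq> I" "lprod u = ?w" using exists_word Cons.prems by blast
  ultimately obtain p s q where pq: "u = p @ s # q" "t \<otimes> ?w = lprod (p @ q)"
    using inversion_deletion[of u t] t Cons.prems(4) by (metis subset_trans)
  have "lprod (p @ q) \<in> generate G I" using u pq I by (intro lprod_in_generate) auto
  then have us': "lprod us \<in> generate G I" using pq w by metis
  have "t = ?w \<otimes> inv (lprod us)" using t us by (simp add: m_assoc)
  then have "t \<in> generate G I" using us' Cons.prems(3) sg by (metis subgroup.m_closed subgroup.m_inv_closed)
  then show ?case using Cons us' by simp
qed auto

text \<open>If a word over \<open>J\<close> for \<open>s\<close> starts with another letter, this
  letter is no inversion of \<open>s\<close>, hence one of the rest of the word; exchange then gives
  a word over \<open>J\<close> that is two letters shorter.\<close>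

lemma generator_in_parabolic:
  assumes "s \<in> S" "J \<subseteq> S" "s \<in> generate G J"
  shows "s \<in> J"
proof -
  obtain u where "set u \<subseteq> J" "lprod u = s" using exists_word assms by blast
  then show ?thesis
  proof (induction u rule: length_induct)
    case (1 u)
    then obtain s' v where u: "u = s' # v" using S_neq_one[OF assms(1)] by (cases u) auto
    show ?case
    proof (cases "s' = s")
      case False
      have s': "s' \<in> S" "set v \<subseteq> S" using 1 u assms by auto
      then have "\<not> inversion (lprod u) s'"
        using False 1 assms by (simp add: inversion_generator)
      moreover have "inversion (lprod u) s' \<longleftrightarrow> inversion s' s' \<noteq> inversion (lprod v) (inv s' \<otimes> s' \<otimes> s')"
        using u s' inversion_mult[of s' "lprod v" s'] by (simp add: S_closed)
      ultimately have "inversion (lprod v) s'"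
        using s' inversion_generator[of s' s'] S_closed[of s'] S_sq[of s'] by simp
      then obtain p x q where "v = p @ x # q" "s' \<otimes> lprod v = lprod (p @ q)"
        using inversion_deletion[of v s'] s' by (metis S_closed)
      moreover have "lprod u = s' \<otimes> lprod v" "length (p @ q) < length u" "set (p @ q) \<subseteq> J"
        using u 1 calculation by auto
      ultimately show ?thesis using 1 by metis
    qed (use 1 u in auto)
  qed
qed

text \<open>Otherwise \<open>s\<close> would lie in the subgroup generated by the other letters.
  This settles the induction below when the list of reflections is empty.\<close>

lemma lprod_distinct_neq_one:
  assumes "set (s # u) \<subseteq> S" "distinct (s # u)"
  shows "lprod (s # u) \<noteq> \<one>"
proof
  assume "lprod (s # u) = \<one>"
  then have "s = lprod (rev u)"
    using assms inv_unique'[of s "lprod u"] inv_equality[of s "lprod u"] by (simp add: lprod_rev S_closed)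
  then have "s \<in> generate G (set u)"
    using lprod_in_generate[of "rev u" "set u"] assms by auto
  then show False using generator_in_parabolic[of s "set u"] assms by auto
qed

text \<open>Each inverse move carries \<open>t\<close> over one letter, keeps that letter and
  conjugates \<open>t\<close> by it.\<close>

lemma hurwitz_push:
  assumes "set p \<subseteq> carrier G" "t \<in> carrier G"
  shows "hurwitz_equiv G (t # p) (p @ [inv (lprod p) \<otimes> t \<otimes> lprod p])"
  using assms
proof (induction p arbitrary: t)
  case (Cons a p)
  let ?t = "inv a \<otimes> t \<otimes> a"
  have cl: "a \<in> carrier G" "set p \<subseteq> carrier G" "t \<in> carrier G" "?t \<in> carrier G"
    using Cons.prems by auto
  then have "t \<otimes> a = a \<otimes> ?t" by (simp add: m_assoc inv_mult_cancel)
  then have "hurwitz_step G (a # ?t # p) (t # a # p)"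
    using hurwitz_step.intros[of a G ?t t "[]" p] cl by simp
  then have "hurwitz_equiv G (t # a # p) (a # ?t # p)"
    using equivclp_sym r_into_equivclp by metis
  also have "hurwitz_equiv G (a # ?t # p) (a # p @ [inv (lprod p) \<otimes> ?t \<otimes> lprod p])"
    by (rule hurwitz_equiv_Cons[OF Cons.IH[OF cl(2,4)]])
  also have "inv (lprod p) \<otimes> ?t \<otimes> lprod p = inv (lprod (a # p)) \<otimes> t \<otimes> lprod (a # p)"
    using cl by (simp add: inv_mult_group m_assoc)
  finally show ?case by simp
qed auto

text \<open>Deleting an entry of \<open>ss\<close> leaves a list of distinct generators, so the
  induction on \<open>ts\<close> can continue. That both lists have the same length is a
  by-product.\<close>

lemma ascending_hurwitz_generators:
  assumes "set ts \<subseteq> refls" "ascending ts" "lprod ts = lprod ss" "set ss \<subseteq> S" "distinct ss"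
  shows "hurwitz_equiv G ts ss"
  using assms
proof (induction ts arbitrary: ss)
  case Nil
  then show ?case using lprod_distinct_neq_one by (cases ss) auto
next
  case (Cons t us)
  have t: "t \<in> refls" "t \<in> carrier G" and us: "lprod us \<in> carrier G"
    using Cons.prems by (auto intro!: lprod_closed)
  have w: "lprod ss \<in> carrier G" "t \<otimes> lprod ss = lprod us"
    using t us Cons.prems by (auto simp flip: Cons.prems(3))
  have "inversion (lprod ss) t"
    using inversion_iff[of t "lprod ss"] not_inversion_len[of t "lprod us"] w t us Cons.prems by simp
  then obtain p s q where pq: "ss = p @ s # q" "t = lprod p \<otimes> s \<otimes> inv (lprod p)" "t \<otimes> lprod ss = lprod (p @ q)"
    using inversion_deletion[of ss t] t Cons.prems by metis
  have p: "set p \<subseteq> S" "s \<in> S" "set q \<subseteq> S" using Cons.prems pq by auto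
  have "hurwitz_equiv G us (p @ q)"
    using Cons w pq by (intro Cons.IH) auto
  then have 1: "hurwitz_equiv G (t # us) (t # p @ q)" by (rule hurwitz_equiv_Cons)
  have "inv (lprod p) \<otimes> t \<otimes> lprod p = s"
    unfolding pq(2) using p by (simp add: m_assoc inv_mult_cancel S_closed)
  then have "hurwitz_equiv G (t # p) (p @ [s])"
    using hurwitz_push[of p t] p t by simp
  from hurwitz_equiv_context[OF this, of "[]" q] have "hurwitz_equiv G (t # p @ q) ss"
    unfolding pq(1) by simp
  with 1 show ?case by (rule equivclp_trans)
qed

end

section \<open>Reflections of the representation are reflections of the Coxeter system\<close>

context coxeter
begin

text \<open>The first letter of a reduced word is a descent, so it commutes with \<open>t\<close>,
  and moving it to the end conjugates the product by it without changing \<open>t\<close>. Iterating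
  brings each letter to the front, so all letters are descents.\<close>

lemma reduced_word_rotate:
  assumes "\<And>s. s \<in> S \<Longrightarrow> len (s \<otimes> t) < len t \<Longrightarrow> s \<otimes> t = t \<otimes> s"
    and "set u \<subseteq> S" "lprod u = t" "length u = len t"
  shows "lprod (rotate i u) = t \<and> (u \<noteq> [] \<longrightarrow> len (hd (rotate i u) \<otimes> t) < len t)"
proof -
  have first: "len (hd v \<otimes> t) < len t" if v: "set v \<subseteq> S" "lprod v = t" "length v = len t" "v \<noteq> []" for v
  proof -
    obtain s v' where v': "v = s # v'" using v(4) by (cases v) auto
    have "s \<otimes> t = lprod v'" unfolding v(2)[symmetric] v' using v(1) v' by simp
    then show ?thesis using len_le[of v'] v(1,3) v' by simp
  qed
  have "lprod (rotate i u) = t"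
  proof (induction i)
    case (Suc i)
    show ?case
    proof (cases "rotate i u")
      case (Cons s v)
      have sv: "set (s # v) \<subseteq> S" "length (s # v) = len t"
        using Cons assms by (metis set_rotate, metis length_rotate)
      then have cl: "s \<in> S" "s \<in> carrier G" "lprod v \<in> carrier G" by auto
      have st: "s \<otimes> lprod v = t" using Suc Cons by simp
      have "len (s \<otimes> t) < len t" using first[of "s # v"] sv st by simp
      then have comm: "s \<otimes> t = t \<otimes> s" using assms(1) cl by simp
      have "lprod v \<otimes> s = (s \<otimes> t) \<otimes> s" unfolding st[symmetric] using cl by simp
      also have "\<dots> = t"
        unfolding comm using cl st S_sq[of s] by (metis m_assoc m_closed r_one)
      finally have "lprod v \<otimes> s = t" .
      then show ?thesis using Cons sv by (simp add: rotate_Suc)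
    qed (use Suc in \<open>simp add: rotate_Suc\<close>)
  qed (use assms in simp)
  then show ?thesis using first[of "rotate i u"] assms by simp
qed

text \<open>Descend through conjugates \<open>s t s\<close> of smaller length until \<open>t\<close> commutes with all
  its descents; the letters of a reduced word of \<open>t\<close> are then all descents, which the hypothesis
  on products forbids unless \<open>t\<close> is one of them.\<close>

lemma commuting_criterion_refls:
  assumes "t \<in> T" "T \<subseteq> carrier G"
    and conj: "\<And>g t. g \<in> carrier G \<Longrightarrow> t \<in> T \<Longrightarrow> g \<otimes> t \<otimes> inv g \<in> T"
    and inv: "\<And>t. t \<in> T \<Longrightarrow> t \<otimes> t = \<one>"
    and prod: "\<And>t u. t \<in> T \<Longrightarrow> set u \<subseteq> S \<Longrightarrow> (\<And>s. s \<in> set u \<Longrightarrow> s \<otimes> t = t \<otimes> s \<and> s \<noteq> t) \<Longrightarrow>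
      lprod u \<noteq> t"
  shows "t \<in> refls"
  using assms(1)
proof (induction "len t" arbitrary: t rule: less_induct)
  case less
  have t: "t \<in> carrier G" "t \<otimes> t = \<one>" using less.prems assms(2) inv by auto
  have invt: "inv t = t" using t by (simp add: inv_equality)
  show ?case
  proof (cases "\<exists>s\<in>S. len (s \<otimes> t \<otimes> s) < len t")
    case True
    then obtain s where s: "s \<in> S" "len (s \<otimes> t \<otimes> s) < len t" by blast
    then have "s \<otimes> t \<otimes> s \<in> T" using conj[of s t] less.prems by simp
    then have "s \<otimes> t \<otimes> s \<in> refls" using less.hyps s by blast
    from refls_conj[OF this, of s] show ?thesis using s t S_sq[of s] by (simp add: m_assoc)
  next
    case False
    \<comment> \<open>As \<open>s t s\<close> is not shorter than \<open>t\<close>, the element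
      \<open>t s\<close> lacks the inversion \<open>s\<close>, while \<open>t = (t s) s\<close> has
      it. So the last factor contributes it, which means that \<open>s\<close> commutes with
      \<open>t s\<close>.\<close>
    have comm: "s \<otimes> t = t \<otimes> s" if s: "s \<in> S" "len (s \<otimes> t) < len t" for s
    proof -
      have "len (t \<otimes> s) = len (s \<otimes> t)"
        using len_inv[of "s \<otimes> t"] s t invt by (simp add: inv_mult_group)
      then have "len (t \<otimes> s) < len (s \<otimes> (t \<otimes> s))" using False s t by (auto simp: m_assoc not_less)
      then have "\<not> inversion (t \<otimes> s) s" using inversion_iff[OF S_refls, of s "t \<otimes> s"] s t by auto
      moreover have "inversion t s" using inversion_iff[OF S_refls, of s t] s t by auto
      moreover have "t \<otimes> s \<otimes> s = t" using s t S_sq[of s] by (simp add: m_assoc)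
      moreover have "inversion (t \<otimes> s \<otimes> s) s \<longleftrightarrow>
          inversion (t \<otimes> s) s \<noteq> inversion s (inv (t \<otimes> s) \<otimes> s \<otimes> (t \<otimes> s))"
        using s t by (intro inversion_mult) auto
      ultimately have "inv (t \<otimes> s) \<otimes> s \<otimes> (t \<otimes> s) = s"
        using inversion_generator[of s "inv (t \<otimes> s) \<otimes> s \<otimes> (t \<otimes> s)"] s t by simp
      then have "s \<otimes> (t \<otimes> s) = (t \<otimes> s) \<otimes> s"
        using s t by (metis S_closed inv_solve_left m_assoc m_closed inv_closed)
      also have "\<dots> = t" by fact
      finally have "s \<otimes> (t \<otimes> s) = t" .
      then show ?thesis using s t by (metis S_cancel m_closed S_closed)
    qed
    obtain u where u: "set u \<subseteq> S" "lprod u = t" "length u = len t" using reduced_word t by blast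
    have "s \<in> S \<and> len (s \<otimes> t) < len t" if s: "s \<in> set u" for s
    proof -
      obtain i where "i < length u" "s = u ! i" using s by (metis in_set_conv_nth)
      moreover from this have "u \<noteq> []" by auto
      ultimately have "s = hd (rotate i u)" "u \<noteq> []" by (simp_all add: hd_rotate_conv_nth)
      then show ?thesis using reduced_word_rotate[OF comm u, of i] u s by auto
    qed
    then obtain s where "s \<in> set u" "s = t" using prod[OF less.prems u(1)] u(2) comm by metis
    then show ?thesis using u S_refls by auto
  qed
qed

end

section \<open>Linear reflections\<close>

lemma finite_dimensional_basis:
  assumes "finite_dimensional TYPE('v::real_vector)"
  obtains B where "finite_dimensional_vector_space (scaleR :: real \<Rightarrow> 'v \<Rightarrow> 'v) B"
proof -
  obtain C :: "'v set" where C: "finite C" "span C = UNIV"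
    using assms by (auto simp: finite_dimensional_def)
  obtain B where B: "B \<subseteq> C" "independent B" "C \<subseteq> span B"
    using maximal_independent_subset by blast
  have "span B = UNIV" using C B by (metis span_mono span_span top.extremum_uniqueI)
  then have "finite_dimensional_vector_space scaleR B"
    using B C finite_subset by unfold_locales (auto simp: dependent_raw_def span_raw_def)
  then show thesis using that by blast
qed

text \<open>The fixed space is a hyperplane. Outside it choose \<open>v0\<close>; every vector is a
  multiple of \<open>v0\<close> up to a fixed vector, so all displacements are multiples of
  \<open>f v0 - v0\<close>, the root.\<close>

lemma linear_reflection_root:
  fixes f :: "'v::real_vector \<Rightarrow> 'v"
  assumes "finite_dimensional TYPE('v)" "linear f"
    and "dim (UNIV :: 'v set) = dim {v. f v - v = 0} + 1"
  obtains v0 \<beta> where "\<beta> \<noteq> 0" "f v0 = v0 + \<beta>" "\<And>v. \<exists>c. f v = v + c *\<^sub>R \<beta>"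
proof -
  let ?F = "{v. f v - v = 0}"
  interpret f: linear f by fact
  obtain B where "finite_dimensional_vector_space (scaleR :: real \<Rightarrow> 'v \<Rightarrow> 'v) B"
    using finite_dimensional_basis[OF assms(1)] .
  then interpret fd: finite_dimensional_vector_space "scaleR :: real \<Rightarrow> 'v \<Rightarrow> 'v" B
    rewrites "vector_space.dim (scaleR :: real \<Rightarrow> 'v \<Rightarrow> 'v) = dim"
      and "module.span (scaleR :: real \<Rightarrow> 'v \<Rightarrow> 'v) = span"
    by (simp_all add: dim_raw_def span_raw_def)
  have sub: "subspace ?F"
    by (auto simp: subspace_def f.add f.scaleR)
  have "?F \<noteq> UNIV" using assms(3) by (metis n_not_Suc_n Suc_eq_plus1)
  then obtain v0 where v0: "v0 \<notin> ?F" by blast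
  have sp: "span ?F = ?F" using sub by simp
  have "dim (insert v0 ?F) = dim (UNIV :: 'v set)"
    using v0 assms(3) fd.dim_insert[of v0 ?F] unfolding sp by simp
  then have full: "span (insert v0 ?F) = UNIV"
    using fd.dim_eq_full[of "insert v0 ?F"] fd.dim_UNIV unfolding fd.dimension_def by simp
  show thesis
  proof (rule that[of "f v0 - v0" v0])
    show "f v0 - v0 \<noteq> 0" using v0 by simp
    show "\<exists>c. f v = v + c *\<^sub>R (f v0 - v0)" for v
    proof -
      obtain k where "v - k *\<^sub>R v0 \<in> ?F"
        using span_breakdown_eq[of v v0 ?F] unfolding full sp by blast
      then have "f v = v + k *\<^sub>R (f v0 - v0)" by (simp add: f.diff f.scaleR algebra_simps)
      then show ?thesis by blast
    qed
  qed simp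
qed

text \<open>The scalar by which \<open>f\<close> acts on \<open>\<beta>\<close> is a real root of
  unity, hence \<open>1\<close> or \<open>-1\<close>. The value \<open>1\<close> would make
  \<open>f\<close> a transvection, which has infinite order.\<close>

lemma linear_reflection_involution:
  fixes f :: "'v::real_vector \<Rightarrow> 'v"
  assumes "linear f" "\<beta> \<noteq> 0" "f v0 = v0 + \<beta>" "\<And>v. \<exists>c. f v = v + c *\<^sub>R \<beta>"
    and "f ^^ n = id" "n > 0"
  shows "f \<beta> = - \<beta>" "f (f v) = v"
proof -
  interpret f: linear f by fact
  obtain c where "f \<beta> = \<beta> + c *\<^sub>R \<beta>" using assms(4) by blast
  then have mu: "f \<beta> = (1 + c) *\<^sub>R \<beta>" by (simp add: algebra_simps)
  have pow: "(f ^^ k) \<beta> = (1 + c) ^ k *\<^sub>R \<beta>" for k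
    by (induction k) (auto simp: f.scaleR mu)
  have "((1 + c) ^ n - 1) *\<^sub>R \<beta> = 0" using pow[of n] assms(5) by (simp add: algebra_simps)
  then have "(1 + c) ^ n = 1" using assms(2) by simp
  then have "\<bar>1 + c\<bar> ^ n = 1" by (simp flip: power_abs)
  then have "\<bar>1 + c\<bar> = 1" using assms(6) power_eq_1_iff[of "\<bar>1 + c\<bar>" n] by simp
  moreover have "c \<noteq> 0"
  proof
    assume "c = 0"
    then have "f \<beta> = \<beta>" using mu by simp
    then have "(f ^^ k) v0 = v0 + real k *\<^sub>R \<beta>" for k
      by (induction k) (simp_all add: f.add f.scaleR assms(3) algebra_simps)
    from this[of n] show False using assms(2,5,6) by simp
  qed
  ultimately have c: "c = -2" by linarith
  then show "f \<beta> = - \<beta>" using mu by simp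
  then show "f (f v) = v" using assms(4)[of v] by (auto simp: f.add f.scaleR)
qed

text \<open>Applied to \<open>g\<close> and to its inverse, the inequality becomes the equality
  behind the closure of \<open>T\<close> under conjugation.\<close>

lemma dim_fixed_conj_le:
  fixes g h f :: "'v::real_vector \<Rightarrow> 'v"
  assumes "finite_dimensional TYPE('v)" "linear g" "\<And>v. h (g v) = v" "\<And>v. g (h v) = v"
  shows "dim {v. g (f (h v)) - v = 0} \<le> dim {v. f v - v = 0}"
proof -
  obtain B where "finite_dimensional_vector_space (scaleR :: real \<Rightarrow> 'v \<Rightarrow> 'v) B"
    using finite_dimensional_basis[OF assms(1)] .
  then interpret fd: finite_dimensional_vector_space_pair_1 "scaleR :: real \<Rightarrow> 'v \<Rightarrow> 'v" B "scaleR :: real \<Rightarrow> 'v \<Rightarrow> 'v"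
    by (simp add: finite_dimensional_vector_space_pair_1_def real_vector.vector_space_axioms)
  have "{v. g (f (h v)) - v = 0} = g ` {v. f v - v = 0}"
  proof (intro Set.set_eqI iffI)
    fix v assume "v \<in> {v. g (f (h v)) - v = 0}"
    then have "g (f (h v)) = v" by simp
    then have "f (h v) = h v" using assms(3) by metis
    then show "v \<in> g ` {v. f v - v = 0}" using assms(4) by (intro image_eqI[of _ _ "h v"]) auto
  qed (use assms(3) in auto)
  then show ?thesis
    using fd.dim_image_le[of g "{v. f v - v = 0}"] assms(2) by (simp add: dim_raw_def linear_def)
qed

lemma reflection_group_root:
  fixes W :: "('a, 'b) monoid_scheme"
  assumes "group W" "finite (carrier W)" "finite_dimensional TYPE('v::real_vector)"
    and \<rho>: "\<rho> \<in> hom W (general_linear :: ('v \<Rightarrow> 'v) monoid)" "t \<in> carrier W"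
    and dim: "dim (UNIV :: 'v set) = dim {v. \<rho> t v - v = 0} + 1"
  obtains \<beta> where "\<beta> \<noteq> 0" "\<And>v. \<exists>c. \<rho> t v = v + c *\<^sub>R \<beta>" "\<rho> t \<beta> = - \<beta>" "\<And>v. \<rho> t (\<rho> t v) = v"
proof -
  interpret group W by fact
  have mult: "\<rho> (x \<otimes>\<^bsub>W\<^esub> y) = \<rho> x \<circ> \<rho> y" if "x \<in> carrier W" "y \<in> carrier W" for x y
    using hom_mult[OF \<rho>(1) that] by (simp add: general_linear_def)
  have lin: "linear (\<rho> x)" "bij (\<rho> x)" if "x \<in> carrier W" for x
    using hom_carrier[OF \<rho>(1)] that by (auto simp: general_linear_def)
  have one: "\<rho> \<one>\<^bsub>W\<^esub> = id"
  proof
    fix v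
    have "\<rho> \<one>\<^bsub>W\<^esub> (\<rho> \<one>\<^bsub>W\<^esub> v) = \<rho> \<one>\<^bsub>W\<^esub> v"
      using mult[of "\<one>\<^bsub>W\<^esub>" "\<one>\<^bsub>W\<^esub>"] by (simp add: fun_eq_iff)
    then show "\<rho> \<one>\<^bsub>W\<^esub> v = id v" using lin(2)[of "\<one>\<^bsub>W\<^esub>"] by (simp add: bij_is_inj inj_eq)
  qed
  have pow: "\<rho> (t [^]\<^bsub>W\<^esub> k) = \<rho> t ^^ k" for k :: nat
    using \<rho>(2) by (induction k) (simp_all add: one mult funpow_Suc_right del: funpow.simps(2))
  have n: "\<rho> t ^^ order W = id" using pow_order_eq_1[OF \<rho>(2)] one pow[of "order W"] by simp
  have n0: "order W > 0" using assms(2) by (simp add: order_gt_0_iff_finite)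
  obtain v0 \<beta> where \<beta>: "\<beta> \<noteq> 0" "\<rho> t v0 = v0 + \<beta>" "\<And>v. \<exists>c. \<rho> t v = v + c *\<^sub>R \<beta>"
    using linear_reflection_root[OF assms(3) lin(1)[OF \<rho>(2)] dim] by metis
  note involution = linear_reflection_involution[OF lin(1)[OF \<rho>(2)] \<beta> n n0]
  show thesis by (rule that[OF \<beta>(1,3) involution])
qed

text \<open>The interface between the representation and the group theory. \<open>T_prod\<close>
  carries the geometric content, in the form that \<open>commuting_criterion_refls\<close> asks
  for.\<close>

locale abstract_reflection_group = group G for G (structure) +
  fixes T :: "'a set"
  assumes T_subset: "T \<subseteq> carrier G"
    and T_conj: "g \<in> carrier G \<Longrightarrow> t \<in> T \<Longrightarrow> g \<otimes> t \<otimes> inv g \<in> T"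
    and T_sq: "t \<in> T \<Longrightarrow> t \<otimes> t = \<one>"
    and T_prod: "t \<in> T \<Longrightarrow> set u \<subseteq> T \<Longrightarrow> (\<And>s. s \<in> set u \<Longrightarrow> s \<otimes> t = t \<otimes> s \<and> s \<noteq> t) \<Longrightarrow> lprod u \<noteq> t"

text \<open>A reflection \<open>s \<noteq> t\<close> commuting with \<open>t\<close> fixes the root of \<open>t\<close>, while \<open>t\<close> negates it.\<close>

lemma reflection_group_abstract:
  fixes W :: "('a, 'b) monoid_scheme"
  assumes "reflection_group TYPE('v::real_vector) W T"
  shows "abstract_reflection_group W T"
proof -
  from assms obtain \<rho> :: "'a \<Rightarrow> 'v \<Rightarrow> 'v" where W: "group W" "finite (carrier W)" "T \<subseteq> carrier W"
    "finite_dimensional TYPE('v)" and \<rho>: "\<rho> \<in> hom W general_linear" "inj_on \<rho> (carrier W)"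
    and dim: "\<And>w. w \<in> carrier W \<Longrightarrow>
      dim (UNIV :: 'v set) = dim {v. \<rho> w v - v = 0} + 1 \<longleftrightarrow> w \<in> T"
    unfolding reflection_group_def by blast
  interpret group W by fact
  have mult: "\<rho> (x \<otimes>\<^bsub>W\<^esub> y) v = \<rho> x (\<rho> y v)" if "x \<in> carrier W" "y \<in> carrier W" for x y v
    using hom_mult[OF \<rho>(1) that] by (simp add: general_linear_def)
  have lin: "linear (\<rho> x)" "bij (\<rho> x)" if "x \<in> carrier W" for x
    using hom_carrier[OF \<rho>(1)] that by (auto simp: general_linear_def)
  have one: "\<rho> \<one>\<^bsub>W\<^esub> v = v" for v
    using mult[of "\<one>\<^bsub>W\<^esub>" "\<one>\<^bsub>W\<^esub>" v] lin(2)[of "\<one>\<^bsub>W\<^esub>"] by (metis bij_is_inj injD l_one one_closed)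
  have faithful: "x = y" if "\<And>v. \<rho> x v = \<rho> y v" "x \<in> carrier W" "y \<in> carrier W" for x y
  proof -
    have "\<rho> x = \<rho> y" using that(1) by (rule ext)
    then show ?thesis using \<rho>(2) that(2,3) by (simp add: inj_on_eq_iff)
  qed
  have inv: "\<rho> x (\<rho> (inv\<^bsub>W\<^esub> x) v) = v" "\<rho> (inv\<^bsub>W\<^esub> x) (\<rho> x v) = v" if "x \<in> carrier W" for x v
    using mult[of x "inv\<^bsub>W\<^esub> x" v] mult[of "inv\<^bsub>W\<^esub> x" x v] that one by auto
  have root: "\<exists>\<beta>. \<beta> \<noteq> 0 \<and> (\<forall>v. \<exists>c. \<rho> t v = v + c *\<^sub>R \<beta>) \<and> \<rho> t \<beta> = - \<beta> \<and> (\<forall>v. \<rho> t (\<rho> t v) = v)"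
    if t: "t \<in> T" for t
  proof -
    have tc: "t \<in> carrier W" using t W(3) by auto
    show ?thesis
      by (rule reflection_group_root[OF W(1,2,4) \<rho>(1) tc iffD2[OF dim[OF tc] t]]) blast
  qed
  have sq: "t \<otimes>\<^bsub>W\<^esub> t = \<one>\<^bsub>W\<^esub>" if "t \<in> T" for t
  proof (rule faithful)
    have "t \<in> carrier W" "\<rho> t (\<rho> t v) = v" for v using that W(3) root[OF that] by auto
    then show "\<rho> (t \<otimes>\<^bsub>W\<^esub> t) v = \<rho> \<one>\<^bsub>W\<^esub> v" for v by (simp add: mult one)
  qed (use that W(3) in auto)
  show ?thesis
  proof
    show "T \<subseteq> carrier W" by fact
    show "t \<otimes>\<^bsub>W\<^esub> t = \<one>\<^bsub>W\<^esub>" if "t \<in> T" for t using sq that .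
    show "g \<otimes>\<^bsub>W\<^esub> t \<otimes>\<^bsub>W\<^esub> inv\<^bsub>W\<^esub> g \<in> T" if "g \<in> carrier W" "t \<in> T" for g t
    proof -
      let ?g' = "inv\<^bsub>W\<^esub> g" and ?c = "g \<otimes>\<^bsub>W\<^esub> t \<otimes>\<^bsub>W\<^esub> inv\<^bsub>W\<^esub> g"
      have cl: "t \<in> carrier W" "?g' \<in> carrier W" "?c \<in> carrier W" using that W(3) by auto
      have c: "\<rho> ?c v = \<rho> g (\<rho> t (\<rho> ?g' v))" for v using cl that mult by simp
      have "dim {v. \<rho> g (\<rho> t (\<rho> ?g' v)) - v = 0} \<le> dim {v. \<rho> t v - v = 0}"
        by (rule dim_fixed_conj_le[where g = "\<rho> g" and h = "\<rho> ?g'" and f = "\<rho> t", OF W(4)])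
          (use that inv lin in auto)
      moreover have "dim {v. \<rho> ?g' (\<rho> ?c (\<rho> g v)) - v = 0} \<le> dim {v. \<rho> ?c v - v = 0}"
        by (rule dim_fixed_conj_le[where g = "\<rho> ?g'" and h = "\<rho> g" and f = "\<rho> ?c", OF W(4)])
          (use that inv lin in auto)
      moreover have "\<rho> ?g' (\<rho> ?c (\<rho> g v)) = \<rho> t v" for v using c inv that cl by simp
      ultimately have "dim {v. \<rho> ?c v - v = 0} = dim {v. \<rho> t v - v = 0}" by (simp add: c)
      then show ?thesis using dim[OF cl(3)] dim[OF cl(1)] that by simp
    qed
    show "list_prod W u \<noteq> t" if t: "t \<in> T" and u: "set u \<subseteq> T"
      and comm: "\<And>s. s \<in> set u \<Longrightarrow> s \<otimes>\<^bsub>W\<^esub> t = t \<otimes>\<^bsub>W\<^esub> s \<and> s \<noteq> t" for t u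
    proof
      obtain \<beta> where \<beta>: "\<beta> \<noteq> 0" "\<And>v. \<exists>c. \<rho> t v = v + c *\<^sub>R \<beta>" "\<rho> t \<beta> = - \<beta>" "\<And>v. \<rho> t (\<rho> t v) = v"
        using root[OF t] by blast
      have tc: "t \<in> carrier W" using t W(3) by auto
      interpret t: linear "\<rho> t" using lin tc by blast
      have fixed: "\<rho> s \<beta> = \<beta>" if s: "s \<in> set u" for s
      proof -
        have sT: "s \<in> T" "s \<in> carrier W" using s u W(3) by auto
        interpret s: linear "\<rho> s" using lin sT by blast
        have swap: "\<rho> t (\<rho> s v) = \<rho> s (\<rho> t v)" for v
          using comm[OF s] mult[OF tc sT(2)] mult[OF sT(2) tc] by metis
        \<comment> \<open>By commutation \<open>t\<close> negates \<open>\<rho> s \<beta>\<close> as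
          well. But \<open>t\<close> moves vectors only along \<open>\<beta>\<close>, so this vector
          lies on the line of \<open>\<beta>\<close>.\<close>
        obtain c where "\<rho> t (\<rho> s \<beta>) = \<rho> s \<beta> + c *\<^sub>R \<beta>" using \<beta>(2) by blast
        then have neg: "- \<rho> s \<beta> = \<rho> s \<beta> + c *\<^sub>R \<beta>" using swap[of \<beta>] \<beta>(3) by (simp add: s.neg)
        have "2 *\<^sub>R \<rho> s \<beta> = \<rho> s \<beta> - (- \<rho> s \<beta>)" by (simp add: scaleR_2)
        also have "\<dots> = (- c) *\<^sub>R \<beta>" unfolding neg by simp
        finally have "2 *\<^sub>R \<rho> s \<beta> = (- c) *\<^sub>R \<beta>" .
        then have "(1/2) *\<^sub>R (2 *\<^sub>R \<rho> s \<beta>) = (1/2) *\<^sub>R ((- c) *\<^sub>R \<beta>)" by (rule arg_cong)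
        then have "\<rho> s \<beta> = (- c / 2) *\<^sub>R \<beta>" by simp
        then obtain l where l: "\<rho> s \<beta> = l *\<^sub>R \<beta>" by blast
        obtain \<gamma> where \<gamma>: "\<And>v. \<exists>c. \<rho> s v = v + c *\<^sub>R \<gamma>" "\<And>v. \<rho> s (\<rho> s v) = v"
          using root[OF sT(1)] by blast
        have "(l * l) *\<^sub>R \<beta> = 1 *\<^sub>R \<beta>" using \<gamma>(2)[of \<beta>] l by (simp add: s.scaleR)
        then have "l * l = 1" using \<beta>(1) by (simp only: scaleR_cancel_right) simp
        then have "l = 1 \<or> l = -1" by (simp add: square_eq_1_iff)
        moreover have "l \<noteq> -1"
        proof
          assume "l = -1"
          then have sb: "\<rho> s \<beta> = - \<beta>" using l by simp
          obtain d where d: "\<rho> s \<beta> = \<beta> + d *\<^sub>R \<gamma>" using \<gamma>(1) by blast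
          have "d *\<^sub>R \<gamma> = \<rho> s \<beta> - \<beta>" using d by simp
          also have "\<dots> = (-2) *\<^sub>R \<beta>" unfolding sb by (simp add: scaleR_2)
          finally have dg: "d *\<^sub>R \<gamma> = (-2) *\<^sub>R \<beta>" .
          then have "d \<noteq> 0" using \<beta>(1) by auto
          have "(1 / d) *\<^sub>R (d *\<^sub>R \<gamma>) = (1 / d) *\<^sub>R ((-2) *\<^sub>R \<beta>)" using dg by (rule arg_cong)
          then have g: "\<gamma> = (-2 / d) *\<^sub>R \<beta>" using \<open>d \<noteq> 0\<close> by simp
          \<comment> \<open>Both roots now lie on one line, so \<open>t s\<close> shifts
            \<open>v\<close> by a multiple \<open>e \<beta>\<close>, and it fixes
            \<open>\<beta>\<close>. A product of commuting involutions squares to the identity,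
            hence \<open>2 e \<beta> = 0\<close>.\<close>
          have "\<rho> (t \<otimes>\<^bsub>W\<^esub> s) v = \<rho> \<one>\<^bsub>W\<^esub> v" for v
          proof -
            obtain k where "\<rho> s v = v + k *\<^sub>R \<gamma>" using \<gamma>(1) by blast
            then have "\<rho> s v = v + (k * (-2 / d)) *\<^sub>R \<beta>" unfolding g by simp
            then obtain j where j: "\<rho> s v = v + j *\<^sub>R \<beta>" by blast
            obtain c where c: "\<rho> t v = v + c *\<^sub>R \<beta>" using \<beta>(2) by blast
            define e where "e = c - j"
            have ts: "\<rho> t (\<rho> s v) = v + e *\<^sub>R \<beta>"
              unfolding j by (simp add: t.add t.scaleR \<beta>(3) c e_def algebra_simps)
            have "v = \<rho> t (\<rho> s (\<rho> t (\<rho> s v)))" using swap \<gamma>(2) \<beta>(4) by simp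
            also have "\<dots> = \<rho> t (\<rho> s (v + e *\<^sub>R \<beta>))" by (simp only: ts)
            also have "\<dots> = \<rho> t (\<rho> s v) + e *\<^sub>R \<beta>"
              by (simp only: s.add t.add s.scaleR t.scaleR sb \<beta>(3) scaleR_minus_right t.neg minus_minus)
            also have "\<dots> = v + 2 *\<^sub>R (e *\<^sub>R \<beta>)" by (simp only: ts scaleR_2 add.assoc)
            finally have "e *\<^sub>R \<beta> = 0" by simp
            then have "\<rho> t (\<rho> s v) = v" by (simp only: ts add_0_right)
            then show ?thesis by (simp only: mult[OF tc sT(2)] one)
          qed
          then have "t \<otimes>\<^bsub>W\<^esub> s = \<one>\<^bsub>W\<^esub>" using faithful[of "t \<otimes>\<^bsub>W\<^esub> s"] tc sT by simp
          then have "s = t" using sq[OF t] tc sT by (metis Units_eq Units_l_cancel)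
          then show False using comm s by blast
        qed
        ultimately show ?thesis using l by simp
      qed
      have "set v \<subseteq> set u \<Longrightarrow> \<rho> (list_prod W v) \<beta> = \<beta>" for v
      proof (induction v)
        case (Cons s v)
        then have "s \<in> carrier W" "list_prod W v \<in> carrier W" using u W(3) by auto
        then show ?case using Cons fixed mult by simp
      qed (simp add: one)
      then have "\<rho> (list_prod W u) \<beta> = \<beta>" by simp
      moreover assume "list_prod W u = t"
      ultimately have "\<beta> = - \<beta>" using \<beta>(3) by simp
      then have "2 *\<^sub>R \<beta> = 0" by (simp add: scaleR_2 eq_neg_iff_add_eq_0)
      then show False using \<beta>(1) by simp
    qed
  qed
qed

section \<open>Decompositions of parabolic Coxeter elements\<close>

lemma list_prod_carrier_update [simp]: "list_prod (G\<lparr>carrier := H\<rparr>) = list_prod G"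
proof
  show "list_prod (G\<lparr>carrier := H\<rparr>) u = list_prod G u" for u by (induction u) auto
qed

lemma hurwitz_equiv_subgroup:
  assumes "hurwitz_equiv (G\<lparr>carrier := H\<rparr>) x y" "H \<subseteq> carrier G"
  shows "hurwitz_equiv G x y"
proof -
  have "hurwitz_step (G\<lparr>carrier := H\<rparr>) u v \<Longrightarrow> hurwitz_step G u v" for u v
    using assms(2) by (auto elim!: hurwitz_step.cases intro!: hurwitz_step.intros[simplified])
  with assms(1) show ?thesis
  proof (induction rule: equivclp_induct)
    case (step y z)
    then show ?case by (metis equivclp_sym equivclp_trans r_into_equivclp)
  qed auto
qed

text \<open>Trades an unordered product for a list without repetitions, the form in which
  \<open>ascending_hurwitz_generators\<close> takes the generators.\<close>

lemma finprod_eq_list_prod: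
  assumes "comm_group (G\<lparr>carrier := H\<rparr>)" "finite A" "A \<subseteq> H"
  shows "\<exists>as. distinct as \<and> set as = A \<and> finprod (G\<lparr>carrier := H\<rparr>) (\<lambda>s. s) A = list_prod G as"
  using assms(2,3)
proof (induction A)
  case empty
  interpret comm_group "G\<lparr>carrier := H\<rparr>" by fact
  show ?case by auto
next
  case (insert x A)
  interpret comm_group "G\<lparr>carrier := H\<rparr>" by fact
  obtain as where "distinct as" "set as = A" "finprod (G\<lparr>carrier := H\<rparr>) (\<lambda>s. s) A = list_prod G as"
    using insert by auto
  moreover have "finprod (G\<lparr>carrier := H\<rparr>) (\<lambda>s. s) (insert x A) =
      x \<otimes>\<^bsub>G\<^esub> finprod (G\<lparr>carrier := H\<rparr>) (\<lambda>s. s) A"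
    using insert by (subst finprod_insert) auto
  ultimately show ?case using insert by (intro exI[of _ "x # as"]) auto
qed

context abstract_reflection_group
begin

lemma hurwitz_equiv_T:
  assumes "hurwitz_equiv G x y" "set x \<subseteq> T"
  shows "set y \<subseteq> T"
  using assms T_subset
proof (rule hurwitz_equiv_closed)
  show "a \<otimes> b \<otimes> inv a \<in> T \<and> inv a \<otimes> b \<otimes> a \<in> T" if "a \<in> T" "b \<in> T" for a b
    using T_conj[of a b] T_conj[of "inv a" b] that T_subset by auto
qed

text \<open>Closure of \<open>T\<close> under conjugation gives one inclusion. For the other, the
  commuting criterion is applied to \<open>T \<inter> H\<close> inside \<open>H\<close>, which
  inherits its conditions from the ambient group.\<close>

lemma refls_eq:
  assumes "subgroup H G" "X \<subseteq> T" and cox: "coxeter_system (G\<lparr>carrier := H\<rparr>) X"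
  shows "coxeter.refls (G\<lparr>carrier := H\<rparr>) X = T \<inter> H"
proof -
  interpret H: group "G\<lparr>carrier := H\<rparr>" using assms(1) subgroup_imp_group by blast
  interpret H: coxeter "G\<lparr>carrier := H\<rparr>" X by unfold_locales fact
  have HG: "H \<subseteq> carrier G" using assms(1) subgroup.subset by blast
  have inv: "inv\<^bsub>G\<lparr>carrier := H\<rparr>\<^esub> h = inv h" if "h \<in> H" for h
    using m_inv_consistent[OF assms(1) that] .
  have XH: "X \<subseteq> H" using H.S_carrier by simp
  show ?thesis
  proof (intro equalityI subsetI)
    fix t assume "t \<in> H.refls"
    then obtain g s where t: "t = g \<otimes>\<^bsub>G\<lparr>carrier := H\<rparr>\<^esub> s \<otimes>\<^bsub>G\<lparr>carrier := H\<rparr>\<^esub> inv\<^bsub>G\<lparr>carrier := H\<rparr>\<^esub> g"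
      "g \<in> carrier (G\<lparr>carrier := H\<rparr>)" "s \<in> X" by (rule H.reflsE)
    moreover have "t \<in> H" using H.refls_closed[OF \<open>t \<in> H.refls\<close>] by simp
    ultimately show "t \<in> T \<inter> H" using inv T_conj[of g s] assms(2) HG by auto
  next
    fix t assume t: "t \<in> T \<inter> H"
    show "t \<in> H.refls"
    proof (rule H.commuting_criterion_refls[where T = "T \<inter> H"])
      show "g \<otimes>\<^bsub>G\<lparr>carrier := H\<rparr>\<^esub> t \<otimes>\<^bsub>G\<lparr>carrier := H\<rparr>\<^esub> inv\<^bsub>G\<lparr>carrier := H\<rparr>\<^esub> g \<in> T \<inter> H"
        if "g \<in> carrier (G\<lparr>carrier := H\<rparr>)" "t \<in> T \<inter> H" for g t
        using that inv[of g] T_conj[of g t] HG assms(1)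
        by (auto intro: subgroup.m_closed subgroup.m_inv_closed)
    qed (use t T_sq T_prod assms(2) in auto)
  qed
qed

end

text \<open>Transitivity is obtained through a base point: every reduced decomposition is connected
  to one list \<open>ss\<close> that enumerates the chromatic pair.\<close>

lemma parabolic_coxeter_hurwitz:
  fixes W :: "('a, 'b) monoid_scheme"
  assumes "reflection_group TYPE('v::real_vector) W T" "parabolic_coxeter_element W T w"
  shows "\<exists>ss. \<forall>ts\<in>Red W T w. hurwitz_equiv W ts ss"
proof -
  interpret abstract_reflection_group W T using reflection_group_abstract[OF assms(1)] .
  have fin: "finite (carrier W)" using assms(1) by (auto simp: reflection_group_def)
  obtain S I L R where I: "I \<subseteq> S" "S \<subseteq> T" "coxeter_system W S"
    and pair: "chromatic_pair (W\<lparr>carrier := generate W I\<rparr>) (T \<inter> generate W I) L R"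
    and w: "w = finprod (W\<lparr>carrier := generate (W\<lparr>carrier := generate W I\<rparr>) L\<rparr>) (\<lambda>s. s) L \<otimes>\<^bsub>W\<^esub>
      finprod (W\<lparr>carrier := generate (W\<lparr>carrier := generate W I\<rparr>) R\<rparr>) (\<lambda>s. s) R"
    using assms(2) unfolding parabolic_coxeter_element_def parabolic_subgroup_def coxeter_elements_def
    by auto
  let ?H = "generate W I"
  let ?W = "W\<lparr>carrier := ?H\<rparr>"
  have ST: "S \<subseteq> carrier W" "I \<subseteq> carrier W" using I T_subset by auto
  have sg: "subgroup ?H W" using ST generate_is_subgroup by blast
  have HW: "?H \<subseteq> carrier W" using sg subgroup.subset by blast
  interpret W: coxeter W S by unfold_locales fact
  interpret H: group ?W using sg subgroup_imp_group by blast
  have LR: "L \<subseteq> T" "R \<subseteq> T" "L \<subseteq> ?H" "R \<subseteq> ?H" "L \<inter> R = {}" "coxeter_system ?W (L \<union> R)"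
    and comm: "comm_group (W\<lparr>carrier := generate ?W L\<rparr>)" "comm_group (W\<lparr>carrier := generate ?W R\<rparr>)"
    using pair by (auto simp: chromatic_pair_def)
  interpret H: coxeter ?W "L \<union> R" by unfold_locales fact
  have W_refls: "W.refls = T"
    using refls_eq[OF subgroup_self I(2)] I(3) T_subset by auto
  have H_refls: "H.refls = T \<inter> ?H"
    using refls_eq[OF sg _ LR(6)] LR by auto
  have "finite L" "finite R" using LR HW fin by (meson finite_subset)+
  moreover have "L \<subseteq> generate ?W L" "R \<subseteq> generate ?W R" by (auto intro: generate.incl)
  ultimately obtain ls rs where ls: "distinct ls" "set ls = L" "finprod (W\<lparr>carrier := generate ?W L\<rparr>) (\<lambda>s. s) L = list_prod W ls"
    and rs: "distinct rs" "set rs = R" "finprod (W\<lparr>carrier := generate ?W R\<rparr>) (\<lambda>s. s) R = list_prod W rs"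
    using finprod_eq_list_prod[OF comm(1)] finprod_eq_list_prod[OF comm(2)] by metis
  have ss: "set (ls @ rs) \<subseteq> L \<union> R" "distinct (ls @ rs)" "list_prod W (ls @ rs) = w"
    using ls rs w LR HW by (simp_all add: order_trans[OF LR(3) HW] order_trans[OF LR(4) HW])
  have wH: "w \<in> ?H"
    using H.word_closed[OF ss(1)] ss(3) by (simp del: lprod_append)
  have "hurwitz_equiv W ts (ls @ rs)" if ts: "ts \<in> Red W T w" for ts
  proof -
    have tsT: "set ts \<subseteq> T" "lprod ts = w" and len: "length ts = reflection_length W T w"
      using ts by (auto simp: Red_def decompositions_def foldr_mult_eq_list_prod lists_eq_set)
    \<comment> \<open>Minimality enters here: cancelling two equal neighbours would leave a
      decomposition two letters shorter.\<close>
    have no_rep: "\<not> hurwitz_equiv W ts (p @ [b, b] @ q)" for p b q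
    proof
      assume eq: "hurwitz_equiv W ts (p @ [b, b] @ q)"
      have sub: "set (p @ [b, b] @ q) \<subseteq> T"
        using hurwitz_equiv_T[OF eq tsT(1)] .
      have "lprod ts = lprod (p @ [b, b] @ q)"
        using hurwitz_equiv_list_prod[OF eq] tsT(1) T_subset by blast
      moreover have "lprod ([b, b] @ q) = lprod q"
      proof -
        have "b \<in> T" "b \<in> carrier W" "lprod q \<in> carrier W" using sub T_subset by auto
        then show ?thesis by (simp add: m_assoc[symmetric] T_sq)
      qed
      ultimately have "lprod (p @ q) = w" using list_prod_append_cong tsT(2) by metis
      then have "p @ q \<in> decompositions W T w"
        using sub by (auto simp: decompositions_def foldr_mult_eq_list_prod lists_eq_set)
      then have "reflection_length W T w \<le> length (p @ q)"
        unfolding reflection_length_def by (intro Least_le) blast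
      then show False using hurwitz_equiv_length[OF eq] len by simp
    qed
    obtain us where us: "hurwitz_equiv W ts us" "W.ascending us"
      using W.hurwitz_ascending no_rep tsT W_refls by blast
    have usT: "set us \<subseteq> T" "lprod us = w"
      using hurwitz_equiv_T[OF us(1)] hurwitz_equiv_list_prod[OF us(1)] tsT T_subset by auto
    then have usW: "set us \<subseteq> ?H"
      using W.ascending_in_parabolic[of us I] us W_refls wH I(1) by simp
    then have usH: "set us \<subseteq> H.refls" using usT H_refls by simp
    \<comment> \<open>So far ascent refers to the length given by \<open>S\<close>, whereas the
      subgroup is measured by \<open>L \<union> R\<close>. The second pass can start because moves
      in the subgroup are moves in \<open>W\<close>, so equal neighbours remain excluded.\<close>
    obtain vs where vs: "hurwitz_equiv ?W us vs" "H.ascending vs"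
    proof -
      have "\<not> hurwitz_equiv ?W us (p @ [b, b] @ q)" for p b q
      proof
        assume "hurwitz_equiv ?W us (p @ [b, b] @ q)"
        from equivclp_trans[OF us(1) hurwitz_equiv_subgroup[OF this HW]] show False using no_rep by blast
      qed
      then show thesis using H.hurwitz_ascending[OF usH] that by blast
    qed
    have "set vs \<subseteq> H.refls"
      by (rule H.hurwitz_equiv_closed[OF vs(1) usH])
        (use H.refls_conj_refl H.refls_closed in auto)
    moreover have "list_prod ?W vs = list_prod ?W (ls @ rs)"
      using H.hurwitz_equiv_list_prod[OF vs(1)] usW usT(2) ss(3) by simp
    ultimately have "hurwitz_equiv ?W vs (ls @ rs)"
      using H.ascending_hurwitz_generators vs(2) ss by blast
    then show ?thesis
      using equivclp_trans[OF us(1) equivclp_trans] hurwitz_equiv_subgroup[OF _ HW] vs(1) by blast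
  qed
  then show ?thesis by blast
qed

section \<open>Groups given by presentations\<close>

lemma presented_eq_words:
  assumes "presented_eq X Q u v" "Q \<subseteq> words X \<times> words X"
  shows "u \<in> words X \<and> v \<in> words X"
  using assms(1) by (induction rule: presented_eq.induct) (use assms(2) in auto)

lemma presented_eq_context:
  assumes "presented_eq X Q u v" "p \<in> words X" "q \<in> words X"
  shows "presented_eq X Q (p @ u @ q) (p @ v @ q)"
  using assms(1)
proof (induction rule: presented_eq.induct)
  case (refl u)
  then show ?case using assms by (intro presented_eq.refl) simp
next
  case (cancel p' q' x e)
  then show ?case using presented_eq.cancel[of "p @ p'" X "q' @ q" x Q e] assms by simp
next
  case (relation p' q' u v)
  then show ?case using presented_eq.relation[of "p @ p'" X "q' @ q" u v Q] assms by simp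
qed (use assms in \<open>auto intro: presented_eq.intros\<close>)

lemma presented_eq_append:
  assumes "presented_eq X Q u u'" "presented_eq X Q v v'" "Q \<subseteq> words X \<times> words X"
  shows "presented_eq X Q (u @ v) (u' @ v')"
proof -
  have "presented_eq X Q (u @ v) (u' @ v)"
    using presented_eq_context[OF assms(1), of "[]" v] presented_eq_words[OF assms(2,3)] by simp
  moreover have "presented_eq X Q (u' @ v) (u' @ v')"
    using presented_eq_context[OF assms(2), of u' "[]"] presented_eq_words[OF assms(1,3)] by simp
  ultimately show ?thesis by (rule presented_eq.trans)
qed

lemma presented_eq_inverse:
  assumes "u \<in> words X"
  shows "presented_eq X Q (map (\<lambda>(x, e). (x, \<not> e)) (rev u) @ u) []"
  using assms
proof (induction u)
  case Nil
  then show ?case by (auto intro: presented_eq.refl)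
next
  case (Cons l u)
  obtain x e where l: "l = (x, e)" by fastforce
  have "map (\<lambda>(x, e). (x, \<not> e)) (rev u) \<in> words X" "u \<in> words X" "x \<in> X"
    using Cons.hyps Cons.prems l by (auto simp: lists_eq_set)
  from presented_eq.cancel[OF this, of Q "\<not> e"] Cons l show ?case
    by (auto intro: presented_eq.trans)
qed

locale presentation =
  fixes X :: "'x set" and Q :: "('x word \<times> 'x word) set"
  assumes relators: "Q \<subseteq> words X \<times> words X"
begin

abbreviation cls :: "'x word \<Rightarrow> 'x word set" where
  "cls u \<equiv> {v. presented_eq X Q u v}"

lemma carrier_presented_group: "carrier (presented_group X Q) = cls ` words X"
  by (auto simp: presented_group_def quotient_def)

lemma presented_groupE:
  assumes "\<beta> \<in> carrier (presented_group X Q)"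
  obtains u where "u \<in> words X" "\<beta> = cls u"
  using assms unfolding carrier_presented_group by (elim imageE)

lemma cls_eq: "presented_eq X Q u v \<Longrightarrow> cls u = cls v"
  by (auto intro: presented_eq.trans presented_eq.sym)

lemma mult_presented_group:
  assumes "u \<in> words X" "v \<in> words X"
  shows "cls u \<otimes>\<^bsub>presented_group X Q\<^esub> cls v = cls (u @ v)"
proof -
  have "presented_eq X Q (u @ v) w" if "presented_eq X Q u a" "presented_eq X Q v b" "presented_eq X Q (a @ b) w" for a b w
    using presented_eq_append[OF that(1,2) relators] that(3) by (rule presented_eq.trans)
  moreover have "\<exists>a. presented_eq X Q u a \<and> (\<exists>b. presented_eq X Q v b \<and> presented_eq X Q (a @ b) w)"
    if "presented_eq X Q (u @ v) w" for w
    using that assms by (intro exI conjI) (rule presented_eq.refl, assumption)+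
  ultimately show ?thesis by (auto simp: presented_group_def)
qed

lemma group_presented_group: "group (presented_group X Q)"
proof (rule groupI)
  let ?P = "presented_group X Q"
  have one: "\<one>\<^bsub>?P\<^esub> = cls []" by (simp add: presented_group_def)
  show "\<one>\<^bsub>?P\<^esub> \<in> carrier ?P" unfolding one carrier_presented_group by blast
  show "x \<otimes>\<^bsub>?P\<^esub> y \<in> carrier ?P" if xy: "x \<in> carrier ?P" "y \<in> carrier ?P" for x y
  proof -
    obtain u where u: "u \<in> words X" "x = cls u" using xy(1) by (rule presented_groupE)
    obtain v where v: "v \<in> words X" "y = cls v" using xy(2) by (rule presented_groupE)
    note uv = u v
    then have "u @ v \<in> words X" by simp
    then show ?thesis
      unfolding uv(2,4) mult_presented_group[OF uv(1,3)] carrier_presented_group by (rule imageI)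
  qed
  show "x \<otimes>\<^bsub>?P\<^esub> y \<otimes>\<^bsub>?P\<^esub> z = x \<otimes>\<^bsub>?P\<^esub> (y \<otimes>\<^bsub>?P\<^esub> z)"
    if xyz: "x \<in> carrier ?P" "y \<in> carrier ?P" "z \<in> carrier ?P" for x y z
  proof -
    obtain u where u: "u \<in> words X" "x = cls u" using xyz(1) by (rule presented_groupE)
    obtain v where v: "v \<in> words X" "y = cls v" using xyz(2) by (rule presented_groupE)
    obtain w where w: "w \<in> words X" "z = cls w" using xyz(3) by (rule presented_groupE)
    note uvw = u v w
    then have "u @ v \<in> words X" "v @ w \<in> words X" by simp_all
    then show ?thesis using uvw(1,3,5) unfolding uvw(2,4,6) by (simp only: mult_presented_group append_assoc)
  qed
  show "\<one>\<^bsub>?P\<^esub> \<otimes>\<^bsub>?P\<^esub> x = x" if x: "x \<in> carrier ?P" for x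
  proof -
    obtain u where u: "u \<in> words X" "x = cls u" using x by (rule presented_groupE)
    then show ?thesis unfolding one u(2) using mult_presented_group[of "[]" u] by simp
  qed
  show "\<exists>y\<in>carrier ?P. y \<otimes>\<^bsub>?P\<^esub> x = \<one>\<^bsub>?P\<^esub>" if x: "x \<in> carrier ?P" for x
  proof -
    obtain u where u: "u \<in> words X" "x = cls u" using x by (rule presented_groupE)
    let ?v = "map (\<lambda>(x, e). (x, \<not> e)) (rev u)"
    have v: "?v \<in> words X" using u(1) by (auto simp: lists_eq_set)
    have "cls ?v \<otimes>\<^bsub>?P\<^esub> x = \<one>\<^bsub>?P\<^esub>"
      unfolding u(2) one mult_presented_group[OF v u(1)] by (rule cls_eq) (rule presented_eq_inverse[OF u(1)])
    moreover have "cls ?v \<in> carrier ?P" unfolding carrier_presented_group using v by (rule imageI)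
    ultimately show ?thesis by blast
  qed
qed

text \<open>The universal property of a presentation, phrased for actions: letters must act
  invertibly on \<open>E\<close> and respect the relators.\<close>

context
  fixes E :: "'e set" and act :: "'x \<times> bool \<Rightarrow> 'e \<Rightarrow> 'e"
  assumes act_closed: "\<And>x e a. x \<in> X \<Longrightarrow> a \<in> E \<Longrightarrow> act (x, e) a \<in> E"
    and act_cancel: "\<And>x e a. x \<in> X \<Longrightarrow> a \<in> E \<Longrightarrow> act (x, e) (act (x, \<not> e) a) = a"
    and act_relation: "\<And>u v a. (u, v) \<in> Q \<Longrightarrow> a \<in> E \<Longrightarrow> foldr act u a = foldr act v a"
begin

lemma foldr_act_closed: "u \<in> words X \<Longrightarrow> a \<in> E \<Longrightarrow> foldr act u a \<in> E"
  by (induction u) (auto simp: act_closed)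

lemma presented_eq_act:
  assumes "presented_eq X Q u v" "a \<in> E"
  shows "foldr act u a = foldr act v a"
  using assms
proof (induction arbitrary: a rule: presented_eq.induct)
  case (cancel p q x e)
  then show ?case using act_cancel[of x "foldr act q a" e] foldr_act_closed by simp
next
  case (relation p q u v)
  then show ?case using act_relation[of u v "foldr act q a"] foldr_act_closed by simp
qed auto

lemma act_some:
  assumes "u \<in> words X" "a \<in> E"
  shows "foldr act (SOME w. w \<in> cls u) a = foldr act u a"
proof -
  have "presented_eq X Q u (SOME w. w \<in> cls u)"
    using someI[of "\<lambda>w. w \<in> cls u" u] presented_eq.refl[OF assms(1)] by simp
  then show ?thesis using presented_eq_act assms(2) by metis
qed

lemma presented_group_action:
  "group_action (presented_group X Q) E (\<lambda>\<beta>. restrict (foldr act (SOME u. u \<in> \<beta>)) E)"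
proof -
  let ?P = "presented_group X Q" and ?f = "\<lambda>\<beta>. restrict (foldr act (SOME u. u \<in> \<beta>)) E"
  have f: "?f (cls u) = restrict (foldr act u) E" if "u \<in> words X" for u
    using act_some[OF that] by (auto intro: restrict_ext)
  have bij: "restrict (foldr act u) E \<in> Bij E" if u: "u \<in> words X" for u
  proof -
    have inv: "map (\<lambda>(x, e). (x, \<not> e)) (rev w) \<in> words X" if "w \<in> words X" for w
      using that by (auto simp: lists_eq_set)
    have cancel: "foldr act (map (\<lambda>(x, e). (x, \<not> e)) (rev w)) (foldr act w a) = a" if "w \<in> words X" "a \<in> E" for w a
      using presented_eq_act[OF presented_eq_inverse[OF that(1)] that(2)] by simp
    let ?v = "map (\<lambda>(x, e). (x, \<not> e)) (rev u)"
    \<comment> \<open>The formal inverse of \<open>?v\<close> is \<open>u\<close> again, so the same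
      cancellation also provides the inverse on the other side.\<close>
    have "map (\<lambda>(x, e). (x, \<not> e)) (rev ?v) = u" by (simp add: rev_map comp_def case_prod_beta)
    then have "foldr act u (foldr act ?v a) = a" if "a \<in> E" for a
      using cancel[OF inv[OF u] that] by simp
    then have "bij_betw (foldr act u) E E"
      using cancel[OF u] foldr_act_closed u inv by (intro bij_betwI[of _ _ _ "foldr act ?v"]) auto
    then show ?thesis by (auto simp: Bij_def bij_betw_restrict_eq)
  qed
  have "?f \<in> hom ?P (BijGroup E)"
  proof (rule homI)
    fix \<beta> assume "\<beta> \<in> carrier ?P"
    then obtain u where "u \<in> words X" "\<beta> = cls u" by (rule presented_groupE)
    then show "?f \<beta> \<in> carrier (BijGroup E)" using f bij by (simp add: BijGroup_def)
  next
    fix \<beta> \<gamma> assume "\<beta> \<in> carrier ?P" "\<gamma> \<in> carrier ?P"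
    obtain u where u: "u \<in> words X" "\<beta> = cls u" using \<open>\<beta> \<in> carrier ?P\<close> by (rule presented_groupE)
    obtain v where v: "v \<in> words X" "\<gamma> = cls v" using \<open>\<gamma> \<in> carrier ?P\<close> by (rule presented_groupE)
    note uv = u v
    have "?f (\<beta> \<otimes>\<^bsub>?P\<^esub> \<gamma>) = restrict (foldr act (u @ v)) E"
      unfolding uv(2,4) mult_presented_group[OF uv(1,3)] using uv by (intro f) auto
    also have "\<dots> = compose E (restrict (foldr act u) E) (restrict (foldr act v) E)"
      using foldr_act_closed[OF uv(3)] by (auto simp: compose_def fun_eq_iff)
    also have "\<dots> = ?f \<beta> \<otimes>\<^bsub>BijGroup E\<^esub> ?f \<gamma>"
      unfolding uv(2,4) f[OF uv(1)] f[OF uv(3)] using bij uv by (simp add: BijGroup_def)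
    finally show "?f (\<beta> \<otimes>\<^bsub>?P\<^esub> \<gamma>) = ?f \<beta> \<otimes>\<^bsub>BijGroup E\<^esub> ?f \<gamma>" .
  qed
  then show ?thesis
    using group_presented_group group_BijGroup
    by (simp add: group_action_def group_hom_def group_hom_axioms_def)
qed

end
end

section \<open>The braid group action\<close>

lemma hurwitz_letter_True_append:
  "length p = i - 1 \<Longrightarrow> i \<ge> 1 \<Longrightarrow>
    hurwitz_letter W (i, True) (p @ a # b # q) = p @ (a \<otimes>\<^bsub>W\<^esub> b \<otimes>\<^bsub>W\<^esub> inv\<^bsub>W\<^esub> a) # a # q"
  by (cases i) (auto simp: nth_append list_update_append Let_def)

lemma hurwitz_letter_False_append:
  "length p = i - 1 \<Longrightarrow> i \<ge> 1 \<Longrightarrow>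
    hurwitz_letter W (i, False) (p @ c # d # q) = p @ d # (inv\<^bsub>W\<^esub> d \<otimes>\<^bsub>W\<^esub> c \<otimes>\<^bsub>W\<^esub> d) # q"
  by (cases i) (auto simp: nth_append list_update_append Let_def)

lemma list_split_at:
  assumes "i < length xs"
  obtains p a q where "xs = p @ a # q" "length p = i"
  using id_take_nth_drop[OF assms] assms by (metis length_take min.absorb4)

lemma list_split_at2:
  assumes "1 \<le> i" "i < length xs"
  obtains p a b q where "xs = p @ a # b # q" "length p = i - 1"
proof -
  obtain p a q where p: "xs = p @ a # q" "length p = i - 1"
    using list_split_at[of "i - 1" xs] assms by (metis less_imp_diff_less)
  then obtain b q' where "q = b # q'" using assms by (cases q) auto
  then show thesis using that p by blast
qed

context group
begin

lemma hurwitz_letter_cancel: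
  assumes "1 \<le> i" "i < length xs" "set xs \<subseteq> carrier G"
  shows "hurwitz_letter G (i, e) (hurwitz_letter G (i, \<not> e) xs) = xs"
proof -
  obtain p a b q where xs: "xs = p @ a # b # q" "length p = i - 1"
    using list_split_at2[OF assms(1,2)] .
  have cl: "a \<in> carrier G" "b \<in> carrier G" using xs assms by auto
  show ?thesis using assms(1) xs cl
    by (cases e) (simp_all del: hurwitz_letter.simps
        add: hurwitz_letter_True_append hurwitz_letter_False_append m_assoc inv_mult_cancel)
qed

lemma hurwitz_letter_step:
  assumes "1 \<le> i" "i < length xs" "set xs \<subseteq> carrier G"
  shows "hurwitz_equiv G xs (hurwitz_letter G (i, e) xs)"
proof -
  obtain p a b q where xs: "xs = p @ a # b # q" "length p = i - 1"
    using list_split_at2[OF assms(1,2)] .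
  have cl: "a \<in> carrier G" "b \<in> carrier G" using xs assms by auto
  show ?thesis
  proof (cases e)
    case True
    have "hurwitz_step G (p @ [a, b] @ q) (p @ [a \<otimes> b \<otimes> inv a, a] @ q)"
      by (rule hurwitz_step.intros) (use cl in \<open>simp_all add: m_assoc\<close>)
    then show ?thesis using True xs assms(1)
      by (simp add: hurwitz_letter_True_append r_into_equivclp del: hurwitz_letter.simps)
  next
    case False
    have "hurwitz_step G (p @ [b, inv b \<otimes> a \<otimes> b] @ q) (p @ [a, b] @ q)"
      by (rule hurwitz_step.intros) (use cl in \<open>simp_all add: m_assoc inv_mult_cancel\<close>)
    from equivclp_sym[OF r_into_equivclp[of "hurwitz_step G", OF this]] show ?thesis using False xs assms(1)
      by (simp add: hurwitz_letter_False_append del: hurwitz_letter.simps)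
  qed
qed

lemma hurwitz_step_letter:
  assumes "hurwitz_step G xs ys"
  shows "\<exists>i. 1 \<le> i \<and> i < length xs \<and> ys = hurwitz_letter G (i, True) xs \<and> xs = hurwitz_letter G (i, False) ys"
  using assms
proof cases
  case (1 a b c p q)
  then have "c = a \<otimes> b \<otimes> inv a" "b = inv a \<otimes> c \<otimes> a"
    by (metis inv_solve_right m_closed, metis inv_solve_left m_closed m_assoc inv_closed)
  then show ?thesis using 1
    by (intro exI[of _ "Suc (length p)"])
       (simp add: hurwitz_letter_True_append hurwitz_letter_False_append del: hurwitz_letter.simps)
qed

lemma hurwitz_letters_commute:
  assumes "1 \<le> i" "i + 1 < j" "j < length xs" "set xs \<subseteq> carrier G"
  shows "hurwitz_letter G (i, True) (hurwitz_letter G (j, True) xs) =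
    hurwitz_letter G (j, True) (hurwitz_letter G (i, True) xs)"
proof -
  have j: "1 \<le> j" "j < length xs" and i: "i < length xs" "i < j - 1" using assms by auto
  obtain p' c d q where xs: "xs = p' @ c # d # q" "length p' = j - 1"
    using list_split_at2[of j xs] assms j by blast
  obtain p a b r where p': "p' = p @ a # b # r" "length p = i - 1"
    using list_split_at2[of i p'] assms(1) i xs(2) by metis
  have second: "hurwitz_letter G (j, True) (p @ x # y # r @ c # d # q) = p @ x # y # r @ (c \<otimes> d \<otimes> inv c) # c # q"
    for x y using hurwitz_letter_True_append[of "p @ x # y # r" j] xs(2) p' j by simp
  have first: "hurwitz_letter G (i, True) (p @ a # b # u) = p @ (a \<otimes> b \<otimes> inv a) # a # u" for u
    using hurwitz_letter_True_append[of p i] p' assms by simp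
  have "xs = p @ a # b # r @ c # d # q" using xs p' by simp
  then show ?thesis using first second by metis
qed

text \<open>Both sides turn neighbours \<open>(a, b, c)\<close> into
  \<open>(a b c b^-1 a^-1, a b a^-1, a)\<close>.\<close>

lemma hurwitz_letters_braid:
  assumes "1 \<le> i" "i + 1 < length xs" "set xs \<subseteq> carrier G"
  shows "hurwitz_letter G (i, True) (hurwitz_letter G (i + 1, True) (hurwitz_letter G (i, True) xs)) =
    hurwitz_letter G (i + 1, True) (hurwitz_letter G (i, True) (hurwitz_letter G (i + 1, True) xs))"
proof -
  have i: "i < length xs" using assms by simp
  obtain p a b q' where xs: "xs = p @ a # b # q'" "length p = i - 1"
    using list_split_at2[OF assms(1) i] by blast
  then obtain c q where q': "q' = c # q" using assms by (cases q') auto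
  have cl: "a \<in> carrier G" "b \<in> carrier G" "c \<in> carrier G" using xs q' assms by auto
  have second: "hurwitz_letter G (i + 1, True) (p @ x # y # z # q) = p @ x # (y \<otimes> z \<otimes> inv y) # y # q" for x y z
    using hurwitz_letter_True_append[of "p @ [x]" "i + 1"] xs assms by simp
  have first: "hurwitz_letter G (i, True) (p @ x # y # z # q) = p @ (x \<otimes> y \<otimes> inv x) # x # z # q" for x y z
    using hurwitz_letter_True_append[of p i] xs assms by simp
  show ?thesis unfolding xs(1) q' first second
    using cl by (simp add: m_assoc inv_mult_group inv_mult_cancel)
qed

text \<open>A chain of moves and inverse moves is spelled as a word in the letters; the class of
  this word is the braid that connects its ends.\<close>

lemma transitive_hurwitz_action:
  assumes E: "\<And>xs. xs \<in> E \<Longrightarrow> set xs \<subseteq> carrier G \<and> length xs = n"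
    and closed: "\<And>xs ys. xs \<in> E \<Longrightarrow> hurwitz_equiv G xs ys \<Longrightarrow> ys \<in> E"
    and equiv: "\<And>xs ys. xs \<in> E \<Longrightarrow> ys \<in> E \<Longrightarrow> hurwitz_equiv G xs ys"
  shows "transitive_action (braid_group n) E (hurwitz_action G E)"
proof -
  let ?X = "{1..<n}" and ?Q = "braid_relations n" and ?L = "hurwitz_letter G"
  interpret presentation ?X ?Q
    by unfold_locales (auto simp: braid_relations_def)
  have act: "\<And>x e a. x \<in> ?X \<Longrightarrow> a \<in> E \<Longrightarrow> ?L (x, e) a \<in> E"
    "\<And>x e a. x \<in> ?X \<Longrightarrow> a \<in> E \<Longrightarrow> ?L (x, e) (?L (x, \<not> e) a) = a"
    using E closed hurwitz_letter_step hurwitz_letter_cancel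
    by (auto simp del: hurwitz_letter.simps)
  have rel: "foldr ?L u a = foldr ?L v a" if "(u, v) \<in> ?Q" "a \<in> E" for u v a
    using that E[of a] hurwitz_letters_commute[of _ _ a] hurwitz_letters_braid[of _ a]
    by (auto simp: braid_relations_def simp del: hurwitz_letter.simps)
  have action: "hurwitz_action G E = (\<lambda>\<beta>. restrict (foldr ?L (SOME u. u \<in> \<beta>)) E)"
    by (simp add: hurwitz_action_def fun_eq_iff)
  have word: "\<exists>u\<in>words ?X. foldr ?L u xs = ys" if "xs \<in> E" "hurwitz_equiv G xs ys" for xs ys
    using that(2,1)
  proof (induction rule: equivclp_induct)
    case base
    show ?case by (rule bexI[of _ "[]"]) auto
  next
    case (step y z)
    then obtain u where u: "u \<in> words ?X" "foldr ?L u xs = y" by blast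
    have y: "y \<in> E" using closed step by blast
    have z: "z \<in> E" using closed[OF y] step(2) by (metis equivclp_sym r_into_equivclp)
    obtain i e where "i \<in> ?X" "z = ?L (i, e) y"
    proof -
      have len: "length y = n" "length z = n" using E y z by auto
      from step(2) consider "hurwitz_step G y z" | "hurwitz_step G z y" by auto
      then obtain i e where "1 \<le> i" "i < n" "z = ?L (i, e) y"
        using hurwitz_step_letter[of y z] hurwitz_step_letter[of z y] len by metis
      then show thesis using that by simp
    qed
    \<comment> \<open>\<open>foldr\<close> applies the last letter first, so the newest move goes to
      the front of the word.\<close>
    then show ?case using u by (intro bexI[of _ "(i, e) # u"]) (auto simp del: hurwitz_letter.simps)
  qed
  interpret group_action "braid_group n" E "hurwitz_action G E"
    unfolding action braid_group_def using presented_group_action[of E ?L] act rel by blast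
  show ?thesis
  proof
    fix xs ys assume xy: "xs \<in> E" "ys \<in> E"
    then obtain u where u: "u \<in> words ?X" "foldr ?L u xs = ys" using word equiv by blast
    have "hurwitz_action G E (cls u) xs = ys"
      using act_some[of E ?L u xs] act rel xy u unfolding action by simp
    moreover have "cls u \<in> carrier (braid_group n)"
      using u(1) unfolding braid_group_def carrier_presented_group by (rule imageI)
    ultimately show "\<exists>\<beta>\<in>carrier (braid_group n). hurwitz_action G E \<beta> xs = ys" by blast
  qed
qed

end

section \<open>Transitivity\<close>

theorem proposition1p6p1:
  fixes W :: "('a, 'b) monoid_scheme" and T :: "'a set" and w :: 'a
  assumes "reflection_group TYPE('v::real_vector) W T"
    and "w \<in> carrier W"
    and "parabolic_coxeter_element W T w"
  shows "transitive_action (braid_group (reflection_length W T w)) (Red W T w)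
           (hurwitz_action W (Red W T w))"
proof -
  interpret abstract_reflection_group W T using reflection_group_abstract[OF assms(1)] .
  obtain ss where ss: "\<And>ts. ts \<in> Red W T w \<Longrightarrow> hurwitz_equiv W ts ss"
    using parabolic_coxeter_hurwitz[OF assms(1,3)] by blast
  have Red: "ts \<in> Red W T w \<longleftrightarrow> set ts \<subseteq> T \<and> lprod ts = w \<and> length ts = reflection_length W T w" for ts
    by (auto simp: Red_def decompositions_def foldr_mult_eq_list_prod lists_eq_set)
  show ?thesis
  proof (rule transitive_hurwitz_action)
    show "set xs \<subseteq> carrier W \<and> length xs = reflection_length W T w" if "xs \<in> Red W T w" for xs
      using that T_subset unfolding Red by blast
    show "ys \<in> Red W T w" if xs: "xs \<in> Red W T w" and eq: "hurwitz_equiv W xs ys" for xs ys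
    proof -
      have "set xs \<subseteq> T" "set xs \<subseteq> carrier W" using xs T_subset unfolding Red by blast+
      then show ?thesis
        using xs hurwitz_equiv_T[OF eq] hurwitz_equiv_list_prod[OF eq] hurwitz_equiv_length[OF eq]
        unfolding Red by simp
    qed
    show "hurwitz_equiv W xs ys" if "xs \<in> Red W T w" "ys \<in> Red W T w" for xs ys
      using equivclp_trans[OF ss[OF that(1)] equivclp_sym[OF ss[OF that(2)]]] .
  qed
qed

end
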